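(* Let $\mathbf{Y}=(Y_t)_{t\in\mathbb{Z}}$ be a (not necessarily stationary) real-valued discrete-time Markov process. For each $t\in\mathbb{Z}$ let $C_{t,t+1}$ be the copula associated to the vector $(Y_t,Y_{t+1})$, and assume that $C_{t,t+1}$ is absolutely continuous with symmetric and square-integrable density $c_{t,t+1}$, and that the family $(c_{t,t+1})_{t\in\mathbb{Z}}$ is uniformly bounded in $L^2([0,1]^2)$, i.e. $\sup_{t\in\mathbb{Z}}\|c_{t,t+1}\|_{L^2([0,1]^2)}<\infty$. Let $\eta_t$ denote the maximal correlation coefficient of $C_{t,t+1}$. If $$\hat\eta=\sup_{t\in\mathbb{Z}}\eta_t<1,$$ then $\mathbf{Y}$ is $\beta$-mixing.
   Context: A bivariate copula is a cumulative distribution function on $[0,1]^2$ with uniform margins on $[0,1]$. The copula $C_{t,t+1}$ associated to $(Y_t,Y_{t+1})$ is the one given by Sklar's theorem: $P(Y_t\le x,\,Y_{t+1}\le y)=C_{t,t+1}(F_t(x),F_{t+1}(y))$ for all real $x,y$, where $F_s$ is the cumulative distribution function of $Y_s$. The density $c_{t,t+1}$ is symmetric if $c_{t,t+1}(u,v)=c_{t,t+1}(v,u)$. The maximal correlation coefficient of a copula $C$ is $$\eta=\sup_{f,g}\left|\int_0^1\int_0^1 f(x)g(y)\,C(dx,dy)\right|,$$ where the supremum is over all $f,g\in L^2([0,1])$ with $\int_0^1 f(x)\,dx=\int_0^1 g(x)\,dx=0$ and $\int_0^1 f^2(x)\,dx=\int_0^1 g^2(x)\,dx=1$. For $-\infty\le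 t\le l\le+\infty$ let $\mathcal{F}_t^l=\sigma(Y_s,\ t\le s\le l)$ (with $s\in\mathbb{Z}$). For $k\ge 1$ define $$\tilde\beta(\mathcal{F}_{-\infty}^{t},\mathcal{F}_{t+k}^{+\infty})=\sup_{\{A_i\},\{B_j\}}\frac12\sum_{i=1}^I\sum_{j=1}^J\left|P(A_i\cap B_j)-P(A_i)P(B_j)\right|,$$ where the supremum is over all finite partitions $\{A_1,\dots,A_I\}$ and $\{B_1,\dots,B_J\}$ of the sample space $\Omega$ with $A_i\in\mathcal{F}_{-\infty}^t$ for each $i$ and $B_j\in\mathcal{F}_{t+k}^{+\infty}$ for each $j$. Put $\beta_k=\sup_{t\in\mathbb{Z}}\tilde\beta(\mathcal{F}_{-\infty}^{t},\mathcal{F}_{t+k}^{+\infty})$. The sequence $(Y_t)_{t\in\mathbb{Z}}$ is called $\beta$-mixing (or absolutely regular) if $\beta_k\to0$ as $k\to+\infty$. *)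

theory Defs
  imports "HOL-Probability.Probability"
begin

definition unit_lebesgue :: "real measure" where
  "unit_lebesgue = restrict_space lborel {0..1}"

abbreviation unit_square_lebesgue :: "(real \<times> real) measure" where
  "unit_square_lebesgue \<equiv> unit_lebesgue \<Otimes>\<^sub>M unit_lebesgue"

definition square_integrable :: "'a measure \<Rightarrow> ('a \<Rightarrow> real) \<Rightarrow> bool" where
  "square_integrable M f \<longleftrightarrow> f \<in> borel_measurable M \<and> integrable M (\<lambda>x. (f x)\<^sup>2)"

definition L2_norm :: "'a measure \<Rightarrow> ('a \<Rightarrow> real) \<Rightarrow> real" where
  "L2_norm M f = sqrt (\<integral>x. (f x)\<^sup>2 \<partial>M)"


text \<open>Copulas. Only the values of \<open>C\<close> on the unit square are meaningful.\<close>

definition is_cdf_on_unit_square :: "(real \<times> real) measure \<Rightarrow> (real \<Rightarrow> real \<Rightarrow> real) \<Rightarrow> bool" where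
  "is_cdf_on_unit_square \<mu> C \<longleftrightarrow>
     prob_space \<mu> \<and> sets \<mu> = sets unit_square_lebesgue \<and>
     (\<forall>u\<in>{0..1}. \<forall>v\<in>{0..1}. C u v = measure \<mu> ({0..u} \<times> {0..v}))"

definition copula :: "(real \<Rightarrow> real \<Rightarrow> real) \<Rightarrow> bool" where
  "copula C \<longleftrightarrow>
     (\<exists>\<mu>. is_cdf_on_unit_square \<mu> C \<and>
          distr \<mu> unit_lebesgue fst = unit_lebesgue \<and>
          distr \<mu> unit_lebesgue snd = unit_lebesgue)"

text \<open>The measure \<open>C(dx, dy)\<close>; see \<open>copula_measure_eqI\<close> for its uniqueness.\<close>

definition copula_measure :: "(real \<Rightarrow> real \<Rightarrow> real) \<Rightarrow> (real \<times> real) measure" where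
  "copula_measure C = (THE \<mu>. is_cdf_on_unit_square \<mu> C)"

text \<open>
  The relation in Sklar's theorem. It determines \<open>C\<close> only on the product of the ranges of the
  two marginal distribution functions, so \<open>C\<close> is unique when these are continuous.
\<close>

definition copula_of ::
  "'a measure \<Rightarrow> ('a \<Rightarrow> real) \<Rightarrow> ('a \<Rightarrow> real) \<Rightarrow> (real \<Rightarrow> real \<Rightarrow> real) \<Rightarrow> bool" where
  "copula_of M X Z C \<longleftrightarrow> copula C \<and>
     (\<forall>x z. \<P>(\<omega> in M. X \<omega> \<le> x \<and> Z \<omega> \<le> z) = C (cdf (distr M borel X) x) (cdf (distr M borel Z) z))"

definition copula_density :: "(real \<Rightarrow> real \<Rightarrow> real) \<Rightarrow> (real \<Rightarrow> real \<Rightarrow> real) \<Rightarrow> bool" where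
  "copula_density C c \<longleftrightarrow>
     (\<lambda>(u, v). c u v) \<in> borel_measurable unit_square_lebesgue \<and>
     (\<forall>u\<in>{0..1}. \<forall>v\<in>{0..1}. 0 \<le> c u v) \<and>
     copula_measure C = density unit_square_lebesgue (\<lambda>(u, v). ennreal (c u v))"

definition symmetric_on_unit_square :: "(real \<Rightarrow> real \<Rightarrow> real) \<Rightarrow> bool" where
  "symmetric_on_unit_square c \<longleftrightarrow> (\<forall>u\<in>{0..1}. \<forall>v\<in>{0..1}. c u v = c v u)"

definition centred_normalized :: "(real \<Rightarrow> real) set" where
  "centred_normalized =
     {f. square_integrable unit_lebesgue f \<and>
         (\<integral>x. f x \<partial>unit_lebesgue) = 0 \<and> (\<integral>x. (f x)\<^sup>2 \<partial>unit_lebesgue) = 1}"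

text \<open>Suprema of nonnegative reals are taken in \<^typ>\<open>ennreal\<close>, where they always exist.\<close>

definition maximal_correlation :: "(real \<Rightarrow> real \<Rightarrow> real) \<Rightarrow> ennreal" where
  "maximal_correlation C =
     (SUP (f, g) \<in> centred_normalized \<times> centred_normalized.
        ennreal \<bar>\<integral>(x, y). f x * g y \<partial>copula_measure C\<bar>)"


definition generated_algebra ::
  "'a measure \<Rightarrow> (int \<Rightarrow> 'a \<Rightarrow> real) \<Rightarrow> int set \<Rightarrow> 'a measure" where
  "generated_algebra M Y I =
     sigma (space M) {Y s -` B \<inter> space M | s B. s \<in> I \<and> B \<in> sets borel}"

abbreviation past :: "'a measure \<Rightarrow> (int \<Rightarrow> 'a \<Rightarrow> real) \<Rightarrow> int \<Rightarrow> 'a measure" where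
  "past M Y t \<equiv> generated_algebra M Y {..t}"

abbreviation future :: "'a measure \<Rightarrow> (int \<Rightarrow> 'a \<Rightarrow> real) \<Rightarrow> int \<Rightarrow> 'a measure" where
  "future M Y t \<equiv> generated_algebra M Y {t..}"

definition markov_process :: "'a measure \<Rightarrow> (int \<Rightarrow> 'a \<Rightarrow> real) \<Rightarrow> bool" where
  "markov_process M Y \<longleftrightarrow>
     prob_space M \<and> (\<forall>t. Y t \<in> borel_measurable M) \<and>
     (\<forall>t. \<forall>B\<in>sets borel. AE \<omega> in M.
        real_cond_exp M (past M Y t) (\<lambda>\<omega>. indicat_real B (Y (t + 1) \<omega>)) \<omega> =
        real_cond_exp M (generated_algebra M Y {t}) (\<lambda>\<omega>. indicat_real B (Y (t + 1) \<omega>)) \<omega>)"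

definition finite_partitions :: "'a measure \<Rightarrow> 'a set set set" where
  "finite_partitions F = {\<A>. finite \<A> \<and> partition_on (space F) \<A> \<and> \<A> \<subseteq> sets F}"

definition beta_dependence :: "'a measure \<Rightarrow> 'a measure \<Rightarrow> 'a measure \<Rightarrow> ennreal" where
  "beta_dependence M F G =
     (SUP (\<A>, \<B>) \<in> finite_partitions F \<times> finite_partitions G.
        ennreal (1 / 2 * (\<Sum>A\<in>\<A>. \<Sum>B\<in>\<B>. \<bar>measure M (A \<inter> B) - measure M A * measure M B\<bar>)))"

definition beta_coefficient :: "'a measure \<Rightarrow> (int \<Rightarrow> 'a \<Rightarrow> real) \<Rightarrow> nat \<Rightarrow> ennreal" where
  "beta_coefficient M Y k = (SUP t. beta_dependence M (past M Y t) (future M Y (t + int k)))"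

definition beta_mixing :: "'a measure \<Rightarrow> (int \<Rightarrow> 'a \<Rightarrow> real) \<Rightarrow> bool" where
  "beta_mixing M Y \<longleftrightarrow> beta_coefficient M Y \<longlonglongrightarrow> 0"


lemma sets_unit_square:
  "sets unit_square_lebesgue =
     sigma_sets ({0..1} \<times> {0..1}) {{0..u} \<times> {0..v} | u v. u \<in> {0..1::real} \<and> v \<in> {0..1::real}}"
proof -
  define \<Omega> :: "(real \<times> real) set" where "\<Omega> = {0..1} \<times> {0..1}"
  define G where "G = {{0..u} \<times> {0..v} | u v. u \<in> {0..1::real} \<and> v \<in> {0..1::real}}"
  define S where "S = sigma \<Omega> G"
  have GP: "G \<subseteq> Pow \<Omega>"
    unfolding G_def \<Omega>_def by fastforce
  have space_S: "space S = \<Omega>" and sets_S: "sets S = sigma_sets \<Omega> G"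
    using GP by (auto simp: S_def space_measure_of_conv)
  have half: "{w \<in> space S. fst w \<le> a} \<in> sets S" "{w \<in> space S. snd w \<le> a} \<in> sets S" for a
  proof -
    consider "a < 0" | "0 \<le> a" "a \<le> 1" | "1 < a" by linarith
    then have "{w \<in> space S. fst w \<le> a} \<in> sets S \<and> {w \<in> space S. snd w \<le> a} \<in> sets S"
    proof cases
      case 1
      then have "{w \<in> space S. fst w \<le> a} = {}" "{w \<in> space S. snd w \<le> a} = {}"
        by (auto simp: space_S \<Omega>_def)
      then show ?thesis by (metis sets.empty_sets)
    next
      case 2
      then have "{w \<in> space S. fst w \<le> a} = {0..a} \<times> {0..1}" "{w \<in> space S. snd w \<le> a} = {0..1} \<times> {0..a}"
        by (auto simp: space_S \<Omega>_def)
      moreover have "{0..a} \<times> {0..1} \<in> G" "{0..1} \<times> {0..a} \<in> G"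
        unfolding G_def using 2 by fastforce+
      ultimately show ?thesis
        by (simp add: sets_S sigma_sets.Basic)
    next
      case 3
      then have "{w \<in> space S. fst w \<le> a} = space S" "{w \<in> space S. snd w \<le> a} = space S"
        by (auto simp: space_S \<Omega>_def)
      then show ?thesis by (metis sets.top)
    qed
    then show "{w \<in> space S. fst w \<le> a} \<in> sets S" "{w \<in> space S. snd w \<le> a} \<in> sets S"
      by auto
  qed
  have "fst \<in> borel_measurable S" "snd \<in> borel_measurable S"
    using half by (simp_all add: borel_measurable_iff_le)
  then have fs: "fst \<in> measurable S unit_lebesgue" "snd \<in> measurable S unit_lebesgue"
    unfolding unit_lebesgue_def
    by (auto intro!: measurable_restrict_space2 simp: space_S \<Omega>_def)
  have "sets unit_square_lebesgue \<subseteq> sets S"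
  proof (rule sets_pair_in_sets)
    fix a b assume ab: "a \<in> sets unit_lebesgue" "b \<in> sets unit_lebesgue"
    then have sub: "a \<subseteq> {0..1}" "b \<subseteq> {0..1}"
      using sets.sets_into_space[of _ unit_lebesgue] by (auto simp: unit_lebesgue_def space_restrict_space)
    have "a \<times> b = (fst -` a \<inter> space S) \<inter> (snd -` b \<inter> space S)"
      using sub by (auto simp: space_S \<Omega>_def)
    also have "\<dots> \<in> sets S"
      using measurable_sets[OF fs(1) ab(1)] measurable_sets[OF fs(2) ab(2)] by blast
    finally show "a \<times> b \<in> sets S" .
  qed
  moreover have "sets S \<subseteq> sets unit_square_lebesgue"
  proof -
    have sp: "space unit_square_lebesgue = \<Omega>"
      by (simp add: space_pair_measure unit_lebesgue_def space_restrict_space \<Omega>_def)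
    have iv: "{0..u} \<in> sets unit_lebesgue" if "u \<in> {0..1}" for u
      using that by (auto simp: unit_lebesgue_def sets_restrict_space_iff)
    have "G \<subseteq> sets unit_square_lebesgue"
      unfolding G_def using iv by auto
    then show ?thesis
      unfolding sets_S sp[symmetric] by (rule sets.sigma_sets_subset)
  qed
  ultimately show ?thesis
    using sets_S unfolding \<Omega>_def G_def by simp
qed

lemma is_cdf_on_unit_square_unique:
  assumes "is_cdf_on_unit_square \<mu> C" "is_cdf_on_unit_square \<nu> C"
  shows "\<mu> = \<nu>"
proof -
  interpret \<mu>: prob_space \<mu> using assms(1) by (simp add: is_cdf_on_unit_square_def)
  interpret \<nu>: prob_space \<nu> using assms(2) by (simp add: is_cdf_on_unit_square_def)
  let ?G = "{{0..u} \<times> {0..v} | u v. u \<in> {0..1::real} \<and> v \<in> {0..1::real}}"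
  show ?thesis
  proof (rule measure_eqI_generator_eq[where E = ?G and \<Omega> = "{0..1} \<times> {0..1}"
        and A = "\<lambda>_. {0..1} \<times> {0..1}"])
    show "Int_stable ?G"
    proof (rule Int_stableI)
      fix a b assume "a \<in> ?G" "b \<in> ?G"
      then obtain u v u' v' where *: "a = {0..u} \<times> {0..v}" "b = {0..u'} \<times> {0..v'}"
        "u \<in> {0..1}" "v \<in> {0..1}" "u' \<in> {0..1}" "v' \<in> {0..1}"
        by blast
      then have "a \<inter> b = {0..min u u'} \<times> {0..min v v'}"
        by auto
      moreover have "min u u' \<in> {0..1}" "min v v' \<in> {0..1}"
        using * by auto
      ultimately show "a \<inter> b \<in> ?G"
        by blast
    qed
    show "?G \<subseteq> Pow ({0..1} \<times> {0..1})"
      by fastforce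
    show "emeasure \<mu> X = emeasure \<nu> X" if "X \<in> ?G" for X
      using that assms
      by (auto simp: is_cdf_on_unit_square_def \<mu>.emeasure_eq_measure \<nu>.emeasure_eq_measure)
    show "range (\<lambda>_::nat. {0..1} \<times> {0..1}) \<subseteq> ?G"
      by fastforce
  qed (use assms sets_unit_square in \<open>auto simp: is_cdf_on_unit_square_def\<close>)
qed

lemma copula_measure_eqI:
  "is_cdf_on_unit_square \<mu> C \<Longrightarrow> copula_measure C = \<mu>"
  unfolding copula_measure_def using is_cdf_on_unit_square_unique by blast

end

theory Submission
  imports Defs
begin

text \<open>
  Dependence between the past up to \<open>t\<close> and the future from \<open>t + n + 1\<close> on has to pass through the
  two neighbouring variables \<open>Y m\<close> and \<open>Y (m + 1)\<close>, where \<open>m = t + n\<close>. For finite partitions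
  \<open>\<A>\<close> of the past and \<open>\<B>\<close> of the future, put the signs of \<open>P(A \<inter> B) - P(A) P(B)\<close> into a function
  of the past: for each \<open>B\<close> there is a centred \<open>S\<^sub>B\<close>, measurable in the past and bounded by 2, with
  \<open>\<Sum>\<^sub>A \<bar>P(A \<inter> B) - P(A) P(B)\<bar> = E[S\<^sub>B 1\<^sub>B]\<close>. By the Markov property this equals \<open>E[R\<^sub>B b\<^sub>B]\<close>, where
  \<open>R\<^sub>B = E[S\<^sub>B | Y m]\<close> and \<open>b\<^sub>B = P(B | Y (m + 1))\<close>. The maximal correlations and the densities
  of the copulas then act separately.

  The maximal correlation acts on the first \<open>n\<close> steps. Passing from the conditional expectation of
  \<open>S\<^sub>B\<close> given \<open>Y s\<close> to the one given \<open>Y (s + 1)\<close> multiplies the norm in \<open>L\<^sup>2\<close> by at most \<open>\<eta>\<close>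
  (\<open>proj_contraction\<close>), so the norm of \<open>R\<^sub>B\<close> is at most \<open>2 \<eta>\<^sup>n\<close> (\<open>proj_decay\<close>). Here \<open>\<eta> < 1\<close>
  can be chosen uniformly in time.

  The density acts on the last step. Correlation alone would bound each \<open>E[R\<^sub>B b\<^sub>B]\<close> separately, and
  the sum over \<open>B\<close> would grow with the partition. But the pair \<open>(Y m, Y (m + 1))\<close> is the image of
  the copula measure under the quantile functions (\<open>joint_law\<close>), so \<open>E[R\<^sub>B b\<^sub>B]\<close> is the integral of
  \<open>r\<^sub>B(u) b\<^sub>B(v) c(u, v)\<close> over the unit square, and the \<open>b\<^sub>B\<close> are nonnegative and sum to 1. The
  inequality between the arithmetic and the geometric mean then bounds the sum over all \<open>B\<close> by
  \<open>\<eta>\<^sup>n (1 + \<parallel>c\<parallel>\<^sup>2)\<close> (\<open>sum_integral_density_le\<close>), uniformly in \<open>t\<close> and in the partitions.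

  All steps before the last are carried by functions of the past that are centred given the present:
  the Markov property keeps them centred given every later variable, and hence given the whole
  future (\<open>cond_centred_future\<close>).
\<close>

section \<open>Functions centred given a sub-\<sigma>-algebra\<close>

text \<open>
  This is \<open>E[D | F] = 0\<close>, stated through integrals so that it is an exact condition, involves no
  choice of a version, and passes to smaller \<sigma>-algebras by restricting the quantifier.
\<close>
definition cond_centred :: "'a measure \<Rightarrow> 'a measure \<Rightarrow> ('a \<Rightarrow> real) \<Rightarrow> bool" where
  "cond_centred M F D \<longleftrightarrow> integrable M D \<and> (\<forall>G\<in>sets F. (LINT \<omega>:G|M. D \<omega>) = 0)"

context sigma_finite_subalgebra
begin

text \<open>
  Going through the conditional expectation of \<open>D\<close>, which vanishes almost everywhere, extends the
  defining property from indicators to all test functions without approximation by simple functions.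
\<close>
lemma cond_centred_integral_eq_0:
  assumes "cond_centred M F D" and "g \<in> borel_measurable F" and "integrable M (\<lambda>\<omega>. g \<omega> * D \<omega>)"
  shows "(\<integral>\<omega>. g \<omega> * D \<omega> \<partial>M) = 0"
proof -
  have D: "integrable M D" and D0: "\<And>G. G \<in> sets F \<Longrightarrow> (LINT \<omega>:G|M. D \<omega>) = 0"
    using assms(1) by (auto simp: cond_centred_def)
  have "AE \<omega> in M. real_cond_exp M F D \<omega> = 0"
    by (rule real_cond_exp_charact) (use D D0 in \<open>auto simp: set_lebesgue_integral_def\<close>)
  then have "(\<integral>\<omega>. g \<omega> * real_cond_exp M F D \<omega> \<partial>M) = 0"
    by (intro integral_eq_zero_AE) auto
  then show ?thesis
    using real_cond_exp_intg(2)[OF assms(3,2)] D by simp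
qed

lemma cond_centred_diff_cond_exp:
  assumes "integrable M f"
  shows "cond_centred M F (\<lambda>\<omega>. f \<omega> - real_cond_exp M F f \<omega>)"
  unfolding cond_centred_def
proof (intro conjI ballI)
  show "integrable M (\<lambda>\<omega>. f \<omega> - real_cond_exp M F f \<omega>)"
    using assms real_cond_exp_int(1) by auto
  fix G assume G: "G \<in> sets F"
  then have GM: "G \<in> sets M"
    using subalg by (auto simp: subalgebra_def)
  have "(LINT \<omega>:G|M. f \<omega> - real_cond_exp M F f \<omega>)
      = (LINT \<omega>:G|M. f \<omega>) - (LINT \<omega>:G|M. real_cond_exp M F f \<omega>)"
    using integrable_mult_indicator[OF GM assms]
      integrable_mult_indicator[OF GM real_cond_exp_int(1)[OF assms]]
    by (intro set_integral_diff) (auto simp: set_integrable_def)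
  then show "(LINT \<omega>:G|M. f \<omega> - real_cond_exp M F f \<omega>) = 0"
    using real_cond_exp_intA[OF assms G] by simp
qed

lemma real_cond_exp_bounded:
  assumes "integrable M f" "AE \<omega> in M. \<bar>f \<omega>\<bar> \<le> K" "integrable M (\<lambda>_. K)"
  shows "AE \<omega> in M. \<bar>real_cond_exp M F f \<omega>\<bar> \<le> K"
proof -
  have neg: "integrable M (\<lambda>_. - K)" using assms(3) by simp
  have K: "AE \<omega> in M. real_cond_exp M F (\<lambda>_. K) \<omega> = K"
          "AE \<omega> in M. real_cond_exp M F (\<lambda>_. - K) \<omega> = - K"
    by (rule real_cond_exp_F_meas[OF assms(3)] real_cond_exp_F_meas[OF neg], simp)+
  have le: "AE \<omega> in M. f \<omega> \<le> K" "AE \<omega> in M. - K \<le> f \<omega>"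
    using assms(2) by (eventually_elim, linarith)+
  note real_cond_exp_mono[OF le(1) assms(1,3)] real_cond_exp_mono[OF le(2) neg assms(1)]
  with K show ?thesis by eventually_elim auto
qed

end

text \<open>
  The Doob--Dynkin factorization. Each sublevel set \<open>{f \<le> q}\<close> with rational \<open>q\<close> is a preimage
  \<open>Y -` B q\<close>, so \<open>f \<omega>\<close> is the infimum of the rationals \<open>q\<close> with \<open>Y \<omega> \<in> B q\<close>, which is a
  function of \<open>Y \<omega>\<close>.
\<close>
lemma doob_dynkin_real:
  fixes f :: "'a \<Rightarrow> real" and Y :: "'a \<Rightarrow> real"
  assumes f: "f \<in> borel_measurable F"
    and F: "\<And>A. A \<in> sets F \<Longrightarrow> \<exists>B\<in>sets borel. A = Y -` B \<inter> space F"
  obtains \<rho> where "\<rho> \<in> borel_measurable borel" "\<And>\<omega>. \<omega> \<in> space F \<Longrightarrow> f \<omega> = \<rho> (Y \<omega>)"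
proof -
  have "\<exists>B\<in>sets borel. {\<omega> \<in> space F. f \<omega> \<le> q} = Y -` B \<inter> space F" for q
    using f by (intro F) measurable
  then obtain B where B: "\<And>q. B q \<in> sets borel"
      "\<And>q. {\<omega> \<in> space F. f \<omega> \<le> q} = Y -` B q \<inter> space F"
    by metis
  \<comment> \<open>The infimum is taken in the extended reals because it may be infinite off the range of \<open>Y\<close>.\<close>
  define \<rho> where "\<rho> y = (INF q\<in>\<rat>. if y \<in> B q then ereal q else \<infinity>)" for y
  have [measurable]: "B q \<in> sets borel" for q by (rule B)
  have "(\<lambda>y. if y \<in> B q then ereal q else \<infinity>) \<in> borel_measurable borel" for q
    by measurable
  then have "\<rho> \<in> borel_measurable borel"
    unfolding \<rho>_def by (intro borel_measurable_INF countable_rat) auto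
  moreover have "\<rho> (Y \<omega>) = ereal (f \<omega>)" if \<omega>: "\<omega> \<in> space F" for \<omega>
  proof -
    have iff: "Y \<omega> \<in> B q \<longleftrightarrow> f \<omega> \<le> q" for q
      using B(2)[of q] \<omega> by auto
    have "\<rho> (Y \<omega>) \<ge> ereal (f \<omega>)"
      unfolding \<rho>_def by (intro INF_greatest) (auto simp: iff)
    moreover have "\<rho> (Y \<omega>) \<le> ereal (f \<omega>)"
    proof (rule ereal_le_epsilon2)
      fix e :: real assume "0 < e"
      then obtain q where q: "q \<in> \<rat>" "f \<omega> < q" "q < f \<omega> + e"
        using Rats_dense_in_real[of "f \<omega>" "f \<omega> + e"] by auto
      have "\<rho> (Y \<omega>) \<le> (if Y \<omega> \<in> B q then ereal q else \<infinity>)"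
        unfolding \<rho>_def by (rule INF_lower) (rule q)
      also have "\<dots> \<le> ereal (f \<omega>) + ereal e"
        using q by (simp add: iff)
      finally show "\<rho> (Y \<omega>) \<le> ereal (f \<omega>) + ereal e" .
    qed
    ultimately show ?thesis by simp
  qed
  ultimately show thesis
    by (intro that[of "\<lambda>y. real_of_ereal (\<rho> y)"]) auto
qed

section \<open>Markov processes and the \<sigma>-algebras they generate\<close>

lemma space_generated_algebra [simp]: "space (generated_algebra M Y I) = space M"
  by (simp add: generated_algebra_def space_measure_of_conv)

lemma sets_generated_algebra:
  "sets (generated_algebra M Y I) =
     sigma_sets (space M) {Y s -` B \<inter> space M | s B. s \<in> I \<and> B \<in> sets borel}"
  unfolding generated_algebra_def by (rule sets_measure_of) auto

lemma measurable_generated_algebra: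
  assumes "s \<in> I" shows "Y s \<in> borel_measurable (generated_algebra M Y I)"
  using assms by (intro measurableI) (auto simp: sets_generated_algebra)

lemma generated_algebra_mono:
  "I \<subseteq> J \<Longrightarrow> sets (generated_algebra M Y I) \<subseteq> sets (generated_algebra M Y J)"
  unfolding sets_generated_algebra by (rule sigma_sets_mono') auto

lemma sets_generated_algebra_singleton:
  "A \<in> sets (generated_algebra M Y {s}) \<longleftrightarrow> (\<exists>B\<in>sets borel. A = Y s -` B \<inter> space M)"
proof
  assume "A \<in> sets (generated_algebra M Y {s})"
  then show "\<exists>B\<in>sets borel. A = Y s -` B \<inter> space M"
    unfolding sets_generated_algebra
  proof induction
    case (Basic a) then show ?case by auto
  next
    case Empty show ?case by (intro bexI[of _ "{}"]) auto
  next
    case (Compl a)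
    then obtain B where "B \<in> sets borel" "a = Y s -` B \<inter> space M" by auto
    then show ?case by (intro bexI[of _ "- B"]) auto
  next
    case (Union a)
    then obtain B where "\<And>i. B i \<in> sets borel" "\<And>i. a i = Y s -` B i \<inter> space M" by metis
    then show ?case by (intro bexI[of _ "\<Union>i. B i"]) auto
  qed
qed (auto simp: sets_generated_algebra)

locale real_markov_process =
  fixes M :: "'a measure" and Y :: "int \<Rightarrow> 'a \<Rightarrow> real"
  assumes markov_process: "markov_process M Y"

sublocale real_markov_process \<subseteq> prob_space M
  using markov_process by (simp add: markov_process_def)

context real_markov_process
begin

abbreviation present :: "int \<Rightarrow> 'a measure" where
  "present t \<equiv> generated_algebra M Y {t}"

lemma measurable_Y [measurable]: "Y t \<in> borel_measurable M"
  using markov_process by (simp add: markov_process_def)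

lemma subalgebra_generated: "subalgebra M (generated_algebra M Y I)"
  unfolding subalgebra_def sets_generated_algebra
  by (auto intro!: sets.sigma_sets_subset)

sublocale generated: finite_measure_subalgebra M "generated_algebra M Y I" for I
  by unfold_locales (rule subalgebra_generated)

text \<open>
  The one-step Markov property in dual form: instead of conditioning future events on the past, it
  moves a function of the past forward. If \<open>D\<close> depends on the past only and is centred given
  \<open>Y t\<close>, then \<open>E[D; Y (t+1) \<in> B] = E[D P(Y (t+1) \<in> B | past)]\<close>, and the Markov property makes the
  second factor a function of \<open>Y t\<close>. In this form the property iterates without any conditional
  expectation of a product.
\<close>
lemma markov_step:
  assumes D: "D \<in> borel_measurable (past M Y t)" and cc: "cond_centred M (present t) D"
  shows "cond_centred M (present (t + 1)) D"
  unfolding cond_centred_def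
proof (intro conjI ballI)
  show int: "integrable M D" using cc by (simp add: cond_centred_def)
  fix G assume "G \<in> sets (present (t + 1))"
  then obtain B where B: "B \<in> sets borel" and G: "G = Y (t + 1) -` B \<inter> space M"
    by (auto simp: sets_generated_algebra_singleton)
  let ?g = "\<lambda>\<omega>. indicat_real B (Y (t + 1) \<omega>)"
  have [measurable]: "B \<in> sets borel" by (rule B)
  have intg: "integrable M (\<lambda>\<omega>. D \<omega> * ?g \<omega>)"
    by (rule Bochner_Integration.integrable_bound[OF int])
      (use int in \<open>auto split: split_indicator\<close>)
  have AE: "AE \<omega> in M. real_cond_exp M (past M Y t) ?g \<omega> = real_cond_exp M (present t) ?g \<omega>"
    using markov_process B by (auto simp: markov_process_def)
  have pres: "integrable M (\<lambda>\<omega>. D \<omega> * real_cond_exp M (past M Y t) ?g \<omega>)"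
    "(\<integral>\<omega>. D \<omega> * real_cond_exp M (past M Y t) ?g \<omega> \<partial>M) = (\<integral>\<omega>. D \<omega> * ?g \<omega> \<partial>M)"
    by (rule generated.real_cond_exp_intg[OF intg D]; measurable)+
  have int2: "integrable M (\<lambda>\<omega>. real_cond_exp M (present t) ?g \<omega> * D \<omega>)"
    by (rule integrable_cong_AE_imp[OF pres(1)])
      (use AE int in \<open>auto simp: mult.commute\<close>)
  have "(LINT \<omega>:G|M. D \<omega>) = (\<integral>\<omega>. D \<omega> * ?g \<omega> \<partial>M)"
    unfolding set_lebesgue_integral_def
    by (intro Bochner_Integration.integral_cong) (auto simp: G split: split_indicator)
  also have "\<dots> = (\<integral>\<omega>. real_cond_exp M (present t) ?g \<omega> * D \<omega> \<partial>M)"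
    unfolding pres(2)[symmetric]
    by (rule integral_cong_AE) (use AE int in \<open>auto simp: mult.commute\<close>)
  also have "\<dots> = 0"
    by (rule generated.cond_centred_integral_eq_0[OF cc _ int2]) simp
  finally show "(LINT \<omega>:G|M. D \<omega>) = 0" .
qed

text \<open>
  By induction on the number of times. The first condition \<open>Y t \<in> B 0\<close> is absorbed into \<open>D\<close>: the
  product is still a function of the past that is centred given \<open>Y t\<close>, so \<open>markov_step\<close> makes it
  centred given \<open>Y (t+1)\<close>, and one time fewer remains.
\<close>
lemma cylinder_integral_eq_0:
  assumes "D \<in> borel_measurable (past M Y t)" and "cond_centred M (present t) D"
    and "\<And>i. B i \<in> sets borel"
  shows "(LINT \<omega>:{\<omega>\<in>space M. \<forall>i\<le>n. Y (t + int i) \<omega> \<in> B i}|M. D \<omega>) = 0"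
  using assms
proof (induction n arbitrary: t D B)
  case 0
  have "{\<omega> \<in> space M. \<forall>i\<le>0. Y (t + int i) \<omega> \<in> B i} = Y t -` B 0 \<inter> space M"
    by auto
  then have "{\<omega> \<in> space M. \<forall>i\<le>0. Y (t + int i) \<omega> \<in> B i} \<in> sets (present t)"
    using 0(3)[of 0] by (auto simp: sets_generated_algebra_singleton)
  then show ?case
    using 0(2) by (simp add: cond_centred_def)
next
  case (Suc n)
  let ?D = "\<lambda>\<omega>. D \<omega> * indicator (B 0) (Y t \<omega>)"
  have [measurable]: "\<And>i. B i \<in> sets borel" by fact
  have int: "integrable M D" using Suc.prems by (simp add: cond_centred_def)
  have Yt [measurable]: "Y t \<in> borel_measurable (past M Y t)" "Y t \<in> borel_measurable (present t)"
    by (auto intro!: measurable_generated_algebra)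
  have D': "?D \<in> borel_measurable (past M Y t)"
    using Suc.prems(1) by measurable
  have cc: "cond_centred M (present t) ?D"
    unfolding cond_centred_def
  proof (intro conjI ballI)
    show "integrable M ?D"
      by (rule Bochner_Integration.integrable_bound[OF int])
        (use int in \<open>auto split: split_indicator\<close>)
    fix G assume G: "G \<in> sets (present t)"
    have "Y t -` B 0 \<inter> space M \<in> sets (present t)"
      by (auto simp: sets_generated_algebra_singleton)
    with G have "G \<inter> (Y t -` B 0 \<inter> space M) \<in> sets (present t)" by (rule sets.Int)
    then have "(LINT \<omega>:G \<inter> (Y t -` B 0 \<inter> space M)|M. D \<omega>) = 0"
      using Suc.prems(2) by (simp add: cond_centred_def)
    also have "(LINT \<omega>:G \<inter> (Y t -` B 0 \<inter> space M)|M. D \<omega>) = (LINT \<omega>:G|M. ?D \<omega>)"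
      unfolding set_lebesgue_integral_def
      by (intro Bochner_Integration.integral_cong) (auto split: split_indicator)
    finally show "(LINT \<omega>:G|M. ?D \<omega>) = 0" .
  qed
  have "sets (past M Y t) \<subseteq> sets (past M Y (t + 1))"
    by (rule generated_algebra_mono) auto
  then have "?D \<in> borel_measurable (past M Y (t + 1))"
    using D' by (auto simp: measurable_def)
  from Suc.IH[OF this markov_step[OF D' cc], of "\<lambda>i. B (Suc i)"]
  have "(LINT \<omega>:{\<omega>\<in>space M. \<forall>i\<le>n. Y (t + 1 + int i) \<omega> \<in> B (Suc i)}|M. ?D \<omega>) = 0"
    by simp
  also have "(LINT \<omega>:{\<omega>\<in>space M. \<forall>i\<le>n. Y (t + 1 + int i) \<omega> \<in> B (Suc i)}|M. ?D \<omega>)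
      = (LINT \<omega>:{\<omega>\<in>space M. \<forall>i\<le>Suc n. Y (t + int i) \<omega> \<in> B i}|M. D \<omega>)"
  proof -
    have "(\<forall>i\<le>Suc n. Y (t + int i) \<omega> \<in> B i) \<longleftrightarrow>
        Y t \<omega> \<in> B 0 \<and> (\<forall>i\<le>n. Y (t + 1 + int i) \<omega> \<in> B (Suc i))" for \<omega>
      by (simp only: less_Suc_eq_le[symmetric] All_less_Suc2) (simp add: add.assoc)
    then show ?thesis
      unfolding set_lebesgue_integral_def
      by (intro Bochner_Integration.integral_cong) (auto split: split_indicator)
  qed
  finally show ?case .
qed

lemma sets_future_cylinders:
  "sets (future M Y t) = sigma_sets (space M)
     {{\<omega>\<in>space M. \<forall>i\<le>n. Y (t + int i) \<omega> \<in> B i} | n B. \<forall>i. B i \<in> sets borel}"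
  (is "_ = sigma_sets _ ?C")
proof
  show "sets (future M Y t) \<subseteq> sigma_sets (space M) ?C"
    unfolding sets_generated_algebra
  proof (rule sigma_sets_mono', safe)
    fix s and B :: "real set" assume s: "t \<le> s" and B: "B \<in> sets borel"
    \<comment> \<open>A condition on the single time \<open>s\<close> is a cylinder whose other factors are \<open>UNIV\<close>.\<close>
    let ?B = "\<lambda>i. if t + int i = s then B else UNIV"
    have "(\<forall>i\<le>nat (s - t). Y (t + int i) \<omega> \<in> ?B i) \<longleftrightarrow> Y s \<omega> \<in> B" for \<omega>
      using s by (auto dest: spec[of _ "nat (s - t)"])
    then have "Y s -` B \<inter> space M = {\<omega>\<in>space M. \<forall>i\<le>nat (s - t). Y (t + int i) \<omega> \<in> ?B i}"
      by auto
    moreover have "\<forall>i. ?B i \<in> sets borel" using B by auto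
    ultimately show "\<exists>n B'. Y s -` B \<inter> space M = {\<omega>\<in>space M. \<forall>i\<le>n. Y (t + int i) \<omega> \<in> B' i}
        \<and> (\<forall>i. B' i \<in> sets borel)"
      by (intro exI[of _ "nat (s - t)"] exI[of _ ?B] conjI)
  qed
  have "?C \<subseteq> sets (future M Y t)"
  proof safe
    fix n and B :: "nat \<Rightarrow> real set" assume "\<forall>i. B i \<in> sets borel"
    then have [measurable]: "\<And>i. B i \<in> sets borel" by simp
    have [measurable]: "Y (t + int i) \<in> borel_measurable (future M Y t)" for i
      by (rule measurable_generated_algebra) simp
    have "{\<omega>\<in>space (future M Y t). \<forall>i\<le>n. Y (t + int i) \<omega> \<in> B i} \<in> sets (future M Y t)"
      by measurable
    then show "{\<omega>\<in>space M. \<forall>i\<le>n. Y (t + int i) \<omega> \<in> B i} \<in> sets (future M Y t)"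
      by (simp only: space_generated_algebra)
  qed
  then show "sigma_sets (space M) ?C \<subseteq> sets (future M Y t)"
    using sets.sigma_sets_subset[of ?C "future M Y t"] by simp
qed

text \<open>
  The Markov property for the whole future. The sets on which \<open>D\<close> integrates to zero contain the
  cylinders, which are closed under intersection, and form a \<lambda>-system.
\<close>
lemma cond_centred_future:
  assumes D: "D \<in> borel_measurable (past M Y t)" and cc: "cond_centred M (present t) D"
  shows "cond_centred M (future M Y t) D"
  unfolding cond_centred_def
proof (intro conjI ballI)
  show int: "integrable M D" using cc by (simp add: cond_centred_def)
  let ?C = "{{\<omega>\<in>space M. \<forall>i\<le>n. Y (t + int i) \<omega> \<in> B i} | n B. \<forall>i. B i \<in> sets borel}"
  have stable: "Int_stable ?C"
  proof (rule Int_stableI)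
    fix a b assume "a \<in> ?C" "b \<in> ?C"
    then obtain n B n' B' where
      *: "a = {\<omega>\<in>space M. \<forall>i\<le>n. Y (t + int i) \<omega> \<in> B i}" "\<forall>i. B i \<in> sets borel"
      "b = {\<omega>\<in>space M. \<forall>i\<le>n'. Y (t + int i) \<omega> \<in> B' i}" "\<forall>i. B' i \<in> sets borel"
      by blast
    let ?B = "\<lambda>i. (if i \<le> n then B i else UNIV) \<inter> (if i \<le> n' then B' i else UNIV)"
    have "a \<inter> b = {\<omega>\<in>space M. \<forall>i\<le>max n n'. Y (t + int i) \<omega> \<in> ?B i}"
      unfolding * by (auto simp: le_max_iff_disj)
    moreover have "\<forall>i. ?B i \<in> sets borel" using * by auto
    ultimately show "a \<inter> b \<in> ?C"
      by (intro CollectI exI[of _ "max n n'"] exI[of _ ?B] conjI)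
  qed
  have sub: "sigma_sets (space M) ?C \<subseteq> sets M"
    using subalgebra_generated sets_future_cylinders by (auto simp: subalgebra_def)
  have D_set: "set_integrable M A D" if "A \<in> sets M" for A
    using integrable_mult_indicator[OF that int] by (simp add: set_integrable_def)
  have total: "(\<integral>\<omega>. D \<omega> \<partial>M) = 0"
  proof -
    have "space M \<in> sets (present t)"
      by (metis sets.top space_generated_algebra)
    then have "(LINT \<omega>:space M|M. D \<omega>) = 0" using cc by (auto simp: cond_centred_def)
    then show ?thesis using set_integral_space[OF int] by simp
  qed
  have closed: "?C \<subseteq> Pow (space M)" by auto
  fix G assume "G \<in> sets (future M Y t)"
  then have "G \<in> sigma_sets (space M) ?C" by (simp only: sets_future_cylinders)
  with stable closed show "(LINT \<omega>:G|M. D \<omega>) = 0"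
  proof (induction rule: sigma_sets_induct_disjoint)
    fix A assume "A \<in> ?C"
    then show "(LINT \<omega>:A|M. D \<omega>) = 0"
      using cylinder_integral_eq_0[OF D cc] by auto
  next
    fix A assume A: "A \<in> sigma_sets (space M) ?C" and A0: "(LINT \<omega>:A|M. D \<omega>) = 0"
    have AM: "A \<in> sets M" using A sub by blast
    then have "(LINT \<omega>:A \<union> (space M - A)|M. D \<omega>) = (LINT \<omega>:A|M. D \<omega>) + (LINT \<omega>:space M - A|M. D \<omega>)"
      using D_set by (intro set_integral_Un) auto
    moreover have "A \<union> (space M - A) = space M" using sets.sets_into_space[OF AM] by auto
    ultimately show "(LINT \<omega>:space M - A|M. D \<omega>) = 0"
      using A0 total set_integral_space[OF int] by simp
  next
    fix A :: "nat \<Rightarrow> 'a set"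
    assume d: "disjoint_family A" and A: "range A \<subseteq> sigma_sets (space M) ?C"
      and 0: "\<And>i. (LINT \<omega>:A i|M. D \<omega>) = 0"
    have AM: "\<And>i. A i \<in> sets M" using A sub by blast
    have "(LINT \<omega>:(\<Union>i. A i)|M. D \<omega>) = (\<Sum>i. (LINT \<omega>:A i|M. D \<omega>))"
      using d AM D_set
      by (intro lebesgue_integral_countable_add) (auto simp: disjoint_family_on_def)
    then show "(LINT \<omega>:(\<Union>i. A i)|M. D \<omega>) = 0" using 0 by simp
  qed (simp add: set_lebesgue_integral_def)
qed

end

section \<open>The quantile coupling with the copula\<close>

lemma space_unit_lebesgue [simp]: "space unit_lebesgue = {0..1}"
  by (simp add: unit_lebesgue_def space_restrict_space)

lemma prob_space_unit_lebesgue: "prob_space unit_lebesgue"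
  unfolding unit_lebesgue_def
  by (auto simp: emeasure_restrict_space space_restrict_space intro!: prob_spaceI)

interpretation unit_lebesgue: prob_space unit_lebesgue
  by (rule prob_space_unit_lebesgue)

interpretation unit_square: pair_prob_space unit_lebesgue unit_lebesgue ..

lemma measurable_unit_lebesgue: "f \<in> borel_measurable borel \<Longrightarrow> f \<in> borel_measurable unit_lebesgue"
  unfolding unit_lebesgue_def by (rule measurable_restrict_space1) simp

lemma AE_unit_lebesgue_interior: "AE u in unit_lebesgue. u \<in> {0<..<1}"
proof -
  have "AE u in lborel. u \<noteq> (0::real)" "AE u in lborel. u \<noteq> (1::real)"
    by (rule AE_lborel_singleton)+
  then have "AE u in lborel. u \<in> {0..1} \<longrightarrow> u \<in> {0<..<1::real}"
    by eventually_elim auto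
  then show ?thesis
    unfolding unit_lebesgue_def by (subst AE_restrict_space_iff) auto
qed

text \<open>
  The generalized inverse of the distribution function. At the endpoints the infimum need not be
  meaningful, since the set can be all of the line or empty; the value 0 is arbitrary there, on a
  null set.
\<close>
definition quantile :: "real measure \<Rightarrow> real \<Rightarrow> real" where
  "quantile N u = (if u \<in> {0<..<1} then Inf {x. u \<le> cdf N x} else 0)"

lemma (in real_distribution) quantile_le_iff:
  assumes "u \<in> {0<..<1}"
  shows "quantile M u \<le> x \<longleftrightarrow> u \<le> cdf M x"
proof -
  interpret cdf_distribution M by unfold_locales
  show ?thesis using pseudoinverse[of u x] assms by (simp add: quantile_def)
qed

lemma (in real_distribution) measurable_quantile: "quantile M \<in> borel_measurable unit_lebesgue"
proof -
  interpret cdf_distribution M by unfold_locales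
  have "(\<lambda>u. if u \<in> {0<..<1::real} then Inf {x. u \<le> cdf M x} else 0) \<in> borel_measurable borel"
    using measurable_CI
    by (subst measurable_If_restrict_space_iff) (auto simp: greaterThanLessThan_def greaterThan_def lessThan_def Int_def)
  then show ?thesis
    unfolding quantile_def[abs_def] by (rule measurable_unit_lebesgue)
qed

lemma copula_copula_measure:
  assumes "copula C"
  shows "is_cdf_on_unit_square (copula_measure C) C"
    and "distr (copula_measure C) unit_lebesgue fst = unit_lebesgue"
    and "distr (copula_measure C) unit_lebesgue snd = unit_lebesgue"
  using assms copula_measure_eqI unfolding copula_def by auto

locale copula_coupling = prob_space M for M :: "'a measure" +
  fixes X Z :: "'a \<Rightarrow> real" and C :: "real \<Rightarrow> real \<Rightarrow> real"
  assumes measurable_X [measurable]: "X \<in> borel_measurable M"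
    and measurable_Z [measurable]: "Z \<in> borel_measurable M"
    and copula_of: "copula_of M X Z C"
begin

abbreviation \<mu> :: "(real \<times> real) measure" where "\<mu> \<equiv> copula_measure C"
abbreviation qX :: "real \<Rightarrow> real" where "qX \<equiv> quantile (distr M borel X)"
abbreviation qZ :: "real \<Rightarrow> real" where "qZ \<equiv> quantile (distr M borel Z)"

sublocale lawX: real_distribution "distr M borel X" by simp
sublocale lawZ: real_distribution "distr M borel Z" by simp

lemma measurable_q [measurable]:
  "qX \<in> borel_measurable unit_lebesgue" "qZ \<in> borel_measurable unit_lebesgue"
  by (rule lawX.measurable_quantile lawZ.measurable_quantile)+

lemma copula: "copula C"
  using copula_of by (simp add: copula_of_def)

lemma sets_\<mu> [measurable_cong]: "sets \<mu> = sets unit_square_lebesgue"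
  using copula_copula_measure(1)[OF copula] by (simp add: is_cdf_on_unit_square_def)

lemma space_\<mu>: "space \<mu> = {0..1} \<times> {0..1}"
  using sets_eq_imp_space_eq[OF sets_\<mu>] by (simp add: space_pair_measure)

sublocale \<mu>: prob_space \<mu>
  using copula_copula_measure(1)[OF copula] by (simp add: is_cdf_on_unit_square_def)

lemma AE_\<mu>_interior: "AE p in \<mu>. fst p \<in> {0<..<1} \<and> snd p \<in> {0<..<1}"
proof -
  have "AE u in distr \<mu> unit_lebesgue fst. u \<in> {0<..<1}"
       "AE u in distr \<mu> unit_lebesgue snd. u \<in> {0<..<1}"
    using AE_unit_lebesgue_interior by (simp_all only: copula_copula_measure(2,3)[OF copula])
  then have "AE p in \<mu>. fst p \<in> {0<..<1}" "AE p in \<mu>. snd p \<in> {0<..<1}"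
    by (auto dest!: AE_distrD[rotated])
  then show ?thesis by eventually_elim simp
qed

text \<open>
  If \<open>(U, V)\<close> has distribution function \<open>C\<close>, then \<open>(qX U, qZ V)\<close> has the joint law of \<open>(X, Z)\<close>.
  On the quadrant below \<open>(x, z)\<close> this is the relation of Sklar's theorem, because \<open>qX u \<le> x\<close> means
  \<open>u \<le> F x\<close>. Quantile functions are used rather than \<open>(F X, G Z)\<close>, whose law is \<open>C\<close> only when the
  margins are continuous.
\<close>
lemma joint_law:
  "distr M borel (\<lambda>\<omega>. (X \<omega>, Z \<omega>)) = distr \<mu> borel (\<lambda>p. (qX (fst p), qZ (snd p)))"
  (is "?L = ?R")
proof (rule measure_eqI_generator_eq[where E = "range (\<lambda>a::real \<times> real. {..a})" and \<Omega> = UNIV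
      and A = "\<lambda>i. {..(real i, real i)}"])
  interpret L: prob_space ?L by (rule prob_space_distr) simp
  interpret R: prob_space ?R
    by (rule \<mu>.prob_space_distr) (simp add: borel_prod[symmetric])
  have m: "(\<lambda>p. (qX (fst p), qZ (snd p))) \<in> borel_measurable \<mu>"
    by (simp add: borel_prod[symmetric])
  show "Int_stable (range (\<lambda>a::real \<times> real. {..a}))"
  proof (rule Int_stableI)
    fix A B :: "(real \<times> real) set" assume "A \<in> range (\<lambda>a. {..a})" "B \<in> range (\<lambda>a. {..a})"
    then obtain a b where "A = {..a}" "B = {..b}" by auto
    then have "A \<inter> B = {..(min (fst a) (fst b), min (snd a) (snd b))}"
      by (auto simp: less_eq_prod_def)
    then show "A \<inter> B \<in> range (\<lambda>a. {..a})" by simp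
  qed
  show "sets ?L = sigma_sets UNIV (range (\<lambda>a. {..a}))" "sets ?R = sigma_sets UNIV (range (\<lambda>a. {..a}))"
    by (simp_all add: borel_eq_atMost)
  show "(\<Union>i. {..(real i, real i)}) = UNIV"
  proof (rule UNIV_eq_I[symmetric])
    fix p :: "real \<times> real"
    obtain i where "max (fst p) (snd p) \<le> real i" using real_arch_simple by blast
    then show "p \<in> (\<Union>i. {..(real i, real i)})" by (auto simp: less_eq_prod_def)
  qed
  show "emeasure ?L {..(real i, real i)} \<noteq> \<infinity>" for i by simp
  fix A :: "(real \<times> real) set" assume "A \<in> range (\<lambda>a. {..a})"
  then obtain x z where A: "A = {..(x, z)}" by auto
  let ?F = "cdf (distr M borel X) x" and ?G = "cdf (distr M borel Z) z"
  have FG: "?F \<in> {0..1}" "?G \<in> {0..1}"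
    by (auto simp: lawX.cdf_bounded_prob lawZ.cdf_bounded_prob lawX.cdf_nonneg lawZ.cdf_nonneg)
  have "measure ?L A = \<P>(\<omega> in M. X \<omega> \<le> x \<and> Z \<omega> \<le> z)"
    by (subst measure_distr) (auto simp: A less_eq_prod_def intro!: arg_cong[where f = "measure M"])
  also have "\<dots> = C ?F ?G"
    using copula_of by (simp add: copula_of_def)
  also have "\<dots> = measure \<mu> ({0..?F} \<times> {0..?G})"
    using copula_copula_measure(1)[OF copula] FG by (simp add: is_cdf_on_unit_square_def)
  also have "\<dots> = measure \<mu> {p\<in>space \<mu>. qX (fst p) \<le> x \<and> qZ (snd p) \<le> z}"
  proof (rule \<mu>.finite_measure_eq_AE)
    show "AE p in \<mu>. p \<in> {0..?F} \<times> {0..?G} \<longleftrightarrow> p \<in> {p\<in>space \<mu>. qX (fst p) \<le> x \<and> qZ (snd p) \<le> z}"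
      using AE_\<mu>_interior AE_space
      by eventually_elim
        (auto simp: space_\<mu> lawX.quantile_le_iff lawZ.quantile_le_iff mem_Times_iff)
    show "{0..?F} \<times> {0..?G} \<in> sets \<mu>"
      using FG unfolding sets_\<mu>
      by (intro pair_measureI) (auto simp: unit_lebesgue_def sets_restrict_space_iff)
    show "{p\<in>space \<mu>. qX (fst p) \<le> x \<and> qZ (snd p) \<le> z} \<in> sets \<mu>"
      by measurable
  qed
  also have "\<dots> = measure ?R A"
    using m by (subst measure_distr) (auto simp: A less_eq_prod_def intro!: arg_cong[where f = "measure \<mu>"])
  finally show "emeasure ?L A = emeasure ?R A"
    by (simp add: L.emeasure_eq_measure R.emeasure_eq_measure)
qed auto

lemma integral_joint_law:
  fixes h :: "real \<times> real \<Rightarrow> real"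
  assumes "h \<in> borel_measurable borel"
  shows "(\<integral>\<omega>. h (X \<omega>, Z \<omega>) \<partial>M) = (\<integral>p. h (qX (fst p), qZ (snd p)) \<partial>\<mu>)"
proof -
  have "(\<integral>\<omega>. h (X \<omega>, Z \<omega>) \<partial>M) = (\<integral>p. h p \<partial>distr M borel (\<lambda>\<omega>. (X \<omega>, Z \<omega>)))"
    using assms by (subst integral_distr) auto
  also have "\<dots> = (\<integral>p. h (qX (fst p), qZ (snd p)) \<partial>\<mu>)"
    unfolding joint_law using assms by (subst integral_distr) (auto simp: borel_prod[symmetric])
  finally show ?thesis .
qed

lemma marginal_law:
  "distr M borel X = distr unit_lebesgue borel qX" "distr M borel Z = distr unit_lebesgue borel qZ"
proof -
  have m: "(\<lambda>p. (qX (fst p), qZ (snd p))) \<in> borel_measurable \<mu>"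
    by (simp add: borel_prod[symmetric])
  have mf: "fst \<in> borel_measurable (borel :: (real \<times> real) measure)"
           "snd \<in> borel_measurable (borel :: (real \<times> real) measure)"
    by (simp_all add: borel_prod[symmetric])
  have "distr M borel X = distr (distr M borel (\<lambda>\<omega>. (X \<omega>, Z \<omega>))) borel fst"
    by (subst distr_distr) (auto simp: comp_def mf)
  also have "\<dots> = distr \<mu> borel (\<lambda>p. qX (fst p))"
    unfolding joint_law using m mf by (subst distr_distr) (auto simp: comp_def)
  also have "\<dots> = distr (distr \<mu> unit_lebesgue fst) borel qX"
    by (subst distr_distr) (auto simp: comp_def)
  finally show "distr M borel X = distr unit_lebesgue borel qX"
    by (simp add: copula_copula_measure[OF copula])
  have "distr M borel Z = distr (distr M borel (\<lambda>\<omega>. (X \<omega>, Z \<omega>))) borel snd"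
    by (subst distr_distr) (auto simp: comp_def mf)
  also have "\<dots> = distr \<mu> borel (\<lambda>p. qZ (snd p))"
    unfolding joint_law using m mf by (subst distr_distr) (auto simp: comp_def)
  also have "\<dots> = distr (distr \<mu> unit_lebesgue snd) borel qZ"
    by (subst distr_distr) (auto simp: comp_def)
  finally show "distr M borel Z = distr unit_lebesgue borel qZ"
    by (simp add: copula_copula_measure[OF copula])
qed

lemma integral_quantile:
  fixes h :: "real \<Rightarrow> real"
  assumes [measurable]: "h \<in> borel_measurable borel"
  shows "(\<integral>u. h (qX u) \<partial>unit_lebesgue) = (\<integral>\<omega>. h (X \<omega>) \<partial>M)"
    and "(\<integral>u. h (qZ u) \<partial>unit_lebesgue) = (\<integral>\<omega>. h (Z \<omega>) \<partial>M)"
    and "integrable unit_lebesgue (\<lambda>u. h (qX u)) \<longleftrightarrow> integrable M (\<lambda>\<omega>. h (X \<omega>))"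
    and "integrable unit_lebesgue (\<lambda>u. h (qZ u)) \<longleftrightarrow> integrable M (\<lambda>\<omega>. h (Z \<omega>))"
proof -
  have "(\<integral>u. h (qX u) \<partial>unit_lebesgue) = integral\<^sup>L (distr unit_lebesgue borel qX) h"
    by (simp add: integral_distr)
  also have "\<dots> = (\<integral>\<omega>. h (X \<omega>) \<partial>M)"
    unfolding marginal_law[symmetric] by (simp add: integral_distr)
  finally show "(\<integral>u. h (qX u) \<partial>unit_lebesgue) = (\<integral>\<omega>. h (X \<omega>) \<partial>M)" .
  have "(\<integral>u. h (qZ u) \<partial>unit_lebesgue) = integral\<^sup>L (distr unit_lebesgue borel qZ) h"
    by (simp add: integral_distr)
  also have "\<dots> = (\<integral>\<omega>. h (Z \<omega>) \<partial>M)"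
    unfolding marginal_law[symmetric] by (simp add: integral_distr)
  finally show "(\<integral>u. h (qZ u) \<partial>unit_lebesgue) = (\<integral>\<omega>. h (Z \<omega>) \<partial>M)" .
  have "integrable unit_lebesgue (\<lambda>u. h (qX u)) \<longleftrightarrow> integrable (distr unit_lebesgue borel qX) h"
    by (simp add: integrable_distr_eq)
  also have "\<dots> \<longleftrightarrow> integrable M (\<lambda>\<omega>. h (X \<omega>))"
    unfolding marginal_law[symmetric] by (simp add: integrable_distr_eq)
  finally show "integrable unit_lebesgue (\<lambda>u. h (qX u)) \<longleftrightarrow> integrable M (\<lambda>\<omega>. h (X \<omega>))" .
  have "integrable unit_lebesgue (\<lambda>u. h (qZ u)) \<longleftrightarrow> integrable (distr unit_lebesgue borel qZ) h"
    by (simp add: integrable_distr_eq)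
  also have "\<dots> \<longleftrightarrow> integrable M (\<lambda>\<omega>. h (Z \<omega>))"
    unfolding marginal_law[symmetric] by (simp add: integrable_distr_eq)
  finally show "integrable unit_lebesgue (\<lambda>u. h (qZ u)) \<longleftrightarrow> integrable M (\<lambda>\<omega>. h (Z \<omega>))" .
qed

text \<open>
  Composing with the quantile functions turns \<open>f\<close> and \<open>g\<close>, after normalization, into admissible
  functions for the supremum that defines the maximal correlation.
\<close>
lemma correlation_le:
  assumes f [measurable]: "f \<in> borel_measurable borel" and g [measurable]: "g \<in> borel_measurable borel"
    and f2: "integrable M (\<lambda>\<omega>. (f (X \<omega>))\<^sup>2)" and g2: "integrable M (\<lambda>\<omega>. (g (Z \<omega>))\<^sup>2)"
    and f0: "(\<integral>\<omega>. f (X \<omega>) \<partial>M) = 0" and g0: "(\<integral>\<omega>. g (Z \<omega>) \<partial>M) = 0"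
    and \<eta>: "maximal_correlation C \<le> ennreal \<eta>" "0 \<le> \<eta>"
  shows "\<bar>\<integral>\<omega>. f (X \<omega>) * g (Z \<omega>) \<partial>M\<bar>
    \<le> \<eta> * sqrt (\<integral>\<omega>. (f (X \<omega>))\<^sup>2 \<partial>M) * sqrt (\<integral>\<omega>. (g (Z \<omega>))\<^sup>2 \<partial>M)"
proof -
  define a where "a = sqrt (\<integral>\<omega>. (f (X \<omega>))\<^sup>2 \<partial>M)"
  define b where "b = sqrt (\<integral>\<omega>. (g (Z \<omega>))\<^sup>2 \<partial>M)"
  have ab: "0 \<le> a" "0 \<le> b" "(\<integral>\<omega>. (f (X \<omega>))\<^sup>2 \<partial>M) = a\<^sup>2" "(\<integral>\<omega>. (g (Z \<omega>))\<^sup>2 \<partial>M) = b\<^sup>2"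
    by (simp_all add: a_def b_def integral_nonneg_AE)
  show ?thesis
  proof (cases "a = 0 \<or> b = 0")
    case True
    \<comment> \<open>A function of norm 0 cannot be normalized, but then the product vanishes almost surely.\<close>
    then have "(AE \<omega> in M. (f (X \<omega>))\<^sup>2 = 0) \<or> (AE \<omega> in M. (g (Z \<omega>))\<^sup>2 = 0)"
      using ab integral_nonneg_eq_0_iff_AE[OF f2] integral_nonneg_eq_0_iff_AE[OF g2] by auto
    then have "AE \<omega> in M. f (X \<omega>) * g (Z \<omega>) = 0" by auto
    then have "(\<integral>\<omega>. f (X \<omega>) * g (Z \<omega>) \<partial>M) = 0" by (rule integral_eq_zero_AE)
    then show ?thesis using ab \<eta> by (simp flip: a_def b_def)
  next
    case False
    then have pos: "a > 0" "b > 0" using ab by auto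
    have F: "(\<lambda>u. f (qX u) / a) \<in> centred_normalized"
      using pos f0 f2 ab integral_quantile(1)[of f] integral_quantile(1,3)[of "\<lambda>x. (f x)\<^sup>2"]
      by (simp add: centred_normalized_def square_integrable_def power_divide)
    have G: "(\<lambda>u. g (qZ u) / b) \<in> centred_normalized"
      using pos g0 g2 ab integral_quantile(2)[of g] integral_quantile(2,4)[of "\<lambda>x. (g x)\<^sup>2"]
      by (simp add: centred_normalized_def square_integrable_def power_divide)
    have "ennreal \<bar>\<integral>(x, y). f (qX x) / a * (g (qZ y) / b) \<partial>\<mu>\<bar> \<le> maximal_correlation C"
      unfolding maximal_correlation_def
      by (rule SUP_upper2[of "(\<lambda>u. f (qX u) / a, \<lambda>u. g (qZ u) / b)"])
        (use F G in \<open>simp_all only: mem_Times_iff fst_conv snd_conv prod.case order_refl\<close>)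
    then have "\<bar>\<integral>(x, y). f (qX x) / a * (g (qZ y) / b) \<partial>\<mu>\<bar> \<le> \<eta>"
      using \<eta> order_trans by (fastforce simp: ennreal_le_iff)
    also have "(\<integral>(x, y). f (qX x) / a * (g (qZ y) / b) \<partial>\<mu>)
        = (\<integral>p. f (qX (fst p)) * g (qZ (snd p)) \<partial>\<mu>) / (a * b)"
      by (simp add: case_prod_beta')
    also have "(\<integral>p. f (qX (fst p)) * g (qZ (snd p)) \<partial>\<mu>) = (\<integral>\<omega>. f (X \<omega>) * g (Z \<omega>) \<partial>M)"
      using integral_joint_law[of "\<lambda>p. f (fst p) * g (snd p)"] by (simp add: borel_prod[symmetric])
    finally show ?thesis
      using pos by (simp add: field_simps flip: a_def b_def)
  qed
qed

text \<open>
  The number of indices does not enter the bound because the functions \<open>b j\<close> sum to at most 1. On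
  the unit square the \<open>j\<close>th term is the integral of \<open>r\<^sub>j(u) b\<^sub>j(v) c(u, v)\<close>, and
  \<open>r\<^sub>j(u) c(u, v) \<le> r\<^sub>j(u)\<^sup>2 / (2 \<epsilon>) + \<epsilon> c(u, v)\<^sup>2 / 2\<close>. After multiplication by \<open>b\<^sub>j(v)\<close> and summation,
  the first part integrates to at most \<open>\<epsilon> / 2\<close>, as \<open>u\<close> and \<open>v\<close> are separated, and the second
  to at most \<open>\<epsilon> / 2\<close> times the squared norm of \<open>c\<close>. The weight \<open>\<epsilon>\<close> balances the small factor
  \<open>r\<^sub>j\<close> against \<open>c\<close>, which is merely bounded in norm.
\<close>
lemma sum_integral_density_le:
  assumes c: "copula_density C c" and c2: "square_integrable unit_square_lebesgue (\<lambda>(u, v). c u v)"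
    and J: "finite J" and \<epsilon>: "0 < \<epsilon>"
    and r [measurable]: "\<And>j. j \<in> J \<Longrightarrow> r j \<in> borel_measurable borel"
    and r2: "\<And>j. j \<in> J \<Longrightarrow> integrable M (\<lambda>\<omega>. (r j (X \<omega>))\<^sup>2)"
      "\<And>j. j \<in> J \<Longrightarrow> (\<integral>\<omega>. (r j (X \<omega>))\<^sup>2 \<partial>M) \<le> \<epsilon>\<^sup>2"
    and b [measurable]: "\<And>j. j \<in> J \<Longrightarrow> b j \<in> borel_measurable borel"
    and b0: "\<And>j z. j \<in> J \<Longrightarrow> 0 \<le> b j z" and b1: "\<And>z. (\<Sum>j\<in>J. b j z) \<le> 1"
  shows "(\<Sum>j\<in>J. \<integral>\<omega>. r j (X \<omega>) * b j (Z \<omega>) \<partial>M)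
    \<le> \<epsilon> / 2 * (1 + (L2_norm unit_square_lebesgue (\<lambda>(u, v). c u v))\<^sup>2)"
proof -
  let ?S = unit_square_lebesgue
  let ?c = "\<lambda>p. c (fst p) (snd p)"
  let ?R = "\<lambda>j u. r j (qX u)" and ?B = "\<lambda>j v. b j (qZ v)"
  have c_meas [measurable]: "?c \<in> borel_measurable ?S" and c_nn: "\<And>p. p \<in> space ?S \<Longrightarrow> 0 \<le> ?c p"
    and \<mu>_eq: "\<mu> = density ?S (\<lambda>p. ennreal (?c p))"
    using c by (auto simp: copula_density_def space_pair_measure case_prod_beta')
  have c_int: "integrable ?S (\<lambda>p. (?c p)\<^sup>2)"
    using c2 by (simp add: square_integrable_def case_prod_beta')
  have b_le1: "b j z \<le> 1" if "j \<in> J" for j z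
    using member_le_sum[OF that, of "\<lambda>j. b j z"] J b0 b1[of z] by fastforce
  have Bint: "integrable unit_lebesgue (?B j)" if j: "j \<in> J" for j
    using j by (intro unit_lebesgue.integrable_const_bound[of _ 1]) (auto simp: b0 b_le1)
  have R2int: "integrable unit_lebesgue (\<lambda>u. (?R j u)\<^sup>2)" if j: "j \<in> J" for j
    using j r2(1)[OF j] integral_quantile(3)[of "\<lambda>x. (r j x)\<^sup>2"] by simp
  have RB: "integrable ?S (\<lambda>p. (?R j (fst p))\<^sup>2 * ?B j (snd p))"
    "(\<integral>p. (?R j (fst p))\<^sup>2 * ?B j (snd p) \<partial>?S) \<le> \<epsilon>\<^sup>2 * (\<integral>v. ?B j v \<partial>unit_lebesgue)"
    if j [simp]: "j \<in> J" for j
  proof -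
    show int: "integrable ?S (\<lambda>p. (?R j (fst p))\<^sup>2 * ?B j (snd p))"
      by (rule unit_square.Fubini_integrable) (use R2int[OF j] Bint[OF j] b0[OF j] in \<open>auto simp: abs_mult\<close>)
    have "(\<integral>p. (?R j (fst p))\<^sup>2 * ?B j (snd p) \<partial>?S)
        = (\<integral>u. (?R j u)\<^sup>2 \<partial>unit_lebesgue) * (\<integral>v. ?B j v \<partial>unit_lebesgue)"
      using unit_square.integral_fst'[OF int] by simp
    also have "(\<integral>u. (?R j u)\<^sup>2 \<partial>unit_lebesgue) = (\<integral>\<omega>. (r j (X \<omega>))\<^sup>2 \<partial>M)"
      using integral_quantile(1)[of "\<lambda>x. (r j x)\<^sup>2"] by simp
    finally show "(\<integral>p. (?R j (fst p))\<^sup>2 * ?B j (snd p) \<partial>?S) \<le> \<epsilon>\<^sup>2 * (\<integral>v. ?B j v \<partial>unit_lebesgue)"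
      using r2(2)[OF j] b0[OF j] by (simp add: mult_right_mono integral_nonneg_AE)
  qed
  let ?T = "\<lambda>j p. ?c p * (?R j (fst p) * ?B j (snd p))"
  have pt: "\<bar>?T j p\<bar> \<le> (?R j (fst p))\<^sup>2 * ?B j (snd p) / (2 * \<epsilon>) + \<epsilon> / 2 * ((?c p)\<^sup>2 * ?B j (snd p))"
    if j: "j \<in> J" for j p
  proof -
    have "\<bar>?c p * ?R j (fst p)\<bar> \<le> (?R j (fst p))\<^sup>2 / (2 * \<epsilon>) + \<epsilon> / 2 * (?c p)\<^sup>2"
    proof -
      have "0 \<le> (\<bar>?R j (fst p)\<bar> - \<epsilon> * \<bar>?c p\<bar>)\<^sup>2 / (2 * \<epsilon>)" using \<epsilon> by simp
      also have "\<dots> = (?R j (fst p))\<^sup>2 / (2 * \<epsilon>) + \<epsilon> / 2 * (?c p)\<^sup>2 - \<bar>?c p * ?R j (fst p)\<bar>"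
        using \<epsilon> by (simp add: power2_diff power_mult_distrib abs_mult field_simps)
          (simp add: power2_eq_square)
      finally show ?thesis by simp
    qed
    from mult_right_mono[OF this b0[OF j, of "qZ (snd p)"]] show ?thesis
      using b0[OF j] by (simp add: abs_mult algebra_simps)
  qed
  have c2B: "integrable ?S (\<lambda>p. (?c p)\<^sup>2 * ?B j (snd p))" if j [simp]: "j \<in> J" for j
    by (rule Bochner_Integration.integrable_bound[OF c_int])
      (use b0[OF j] b_le1[OF j] in \<open>auto simp: abs_mult intro!: AE_I2 mult_left_le\<close>)
  have Tint: "integrable ?S (?T j)" if j [simp]: "j \<in> J" for j
  proof (rule Bochner_Integration.integrable_bound)
    show "integrable ?S (\<lambda>p. (?R j (fst p))\<^sup>2 * ?B j (snd p) / (2 * \<epsilon>) + \<epsilon> / 2 * ((?c p)\<^sup>2 * ?B j (snd p)))"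
      using RB(1)[OF j] c2B[OF j] by simp
    show "AE p in ?S. norm (?T j p) \<le> norm ((?R j (fst p))\<^sup>2 * ?B j (snd p) / (2 * \<epsilon>) + \<epsilon> / 2 * ((?c p)\<^sup>2 * ?B j (snd p)))"
      unfolding real_norm_def using pt[OF j] by (intro AE_I2) (rule order_trans[OF _ abs_ge_self])
  qed measurable
  have "(\<Sum>j\<in>J. \<integral>\<omega>. r j (X \<omega>) * b j (Z \<omega>) \<partial>M) = (\<Sum>j\<in>J. \<integral>p. ?T j p \<partial>?S)"
  proof (rule sum.cong[OF refl])
    fix j assume j [simp]: "j \<in> J"
    have "(\<integral>\<omega>. r j (X \<omega>) * b j (Z \<omega>) \<partial>M) = (\<integral>p. ?R j (fst p) * ?B j (snd p) \<partial>\<mu>)"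
      using integral_joint_law[of "\<lambda>p. r j (fst p) * b j (snd p)"] by (simp add: borel_prod[symmetric])
    also have "\<dots> = (\<integral>p. ?T j p \<partial>?S)"
      unfolding \<mu>_eq by (subst integral_density) (auto simp: c_nn)
    finally show "(\<integral>\<omega>. r j (X \<omega>) * b j (Z \<omega>) \<partial>M) = (\<integral>p. ?T j p \<partial>?S)" .
  qed
  also have "\<dots> \<le> (\<Sum>j\<in>J. \<integral>p. (?R j (fst p))\<^sup>2 * ?B j (snd p) / (2 * \<epsilon>) + \<epsilon> / 2 * ((?c p)\<^sup>2 * ?B j (snd p)) \<partial>?S)"
    using pt RB(1) c2B Tint by (intro sum_mono integral_mono) (auto intro: order_trans[OF abs_ge_self])
  also have "\<dots> = (\<Sum>j\<in>J. (\<integral>p. (?R j (fst p))\<^sup>2 * ?B j (snd p) \<partial>?S)) / (2 * \<epsilon>)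
      + \<epsilon> / 2 * (\<Sum>j\<in>J. \<integral>p. (?c p)\<^sup>2 * ?B j (snd p) \<partial>?S)"
    using RB(1) c2B by (simp add: sum.distrib sum_divide_distrib sum_distrib_left)
  also have "\<dots> \<le> \<epsilon>\<^sup>2 / (2 * \<epsilon>) + \<epsilon> / 2 * (\<integral>p. (?c p)\<^sup>2 \<partial>?S)"
  proof (intro add_mono divide_right_mono mult_left_mono)
    have "(\<Sum>j\<in>J. \<integral>p. (?R j (fst p))\<^sup>2 * ?B j (snd p) \<partial>?S) \<le> (\<Sum>j\<in>J. \<epsilon>\<^sup>2 * (\<integral>v. ?B j v \<partial>unit_lebesgue))"
      by (intro sum_mono RB(2))
    also have "\<dots> = \<epsilon>\<^sup>2 * (\<integral>v. (\<Sum>j\<in>J. ?B j v) \<partial>unit_lebesgue)"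
      using Bint by (simp add: sum_distrib_left)
    also have "\<dots> \<le> \<epsilon>\<^sup>2 * (\<integral>v. 1 \<partial>unit_lebesgue)"
      using Bint b1 by (intro mult_left_mono integral_mono) auto
    finally show "(\<Sum>j\<in>J. \<integral>p. (?R j (fst p))\<^sup>2 * ?B j (snd p) \<partial>?S) \<le> \<epsilon>\<^sup>2"
      by (simp add: unit_lebesgue.prob_space[simplified])
    have "(\<Sum>j\<in>J. \<integral>p. (?c p)\<^sup>2 * ?B j (snd p) \<partial>?S) = (\<integral>p. (?c p)\<^sup>2 * (\<Sum>j\<in>J. ?B j (snd p)) \<partial>?S)"
      using c2B by (simp add: sum_distrib_left)
    also have "\<dots> \<le> (\<integral>p. (?c p)\<^sup>2 \<partial>?S)"
      using c2B c_int b1 by (intro integral_mono) (auto simp: sum_distrib_left[symmetric] intro!: mult_left_le, simp add: sum_distrib_left)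
    finally show "(\<Sum>j\<in>J. \<integral>p. (?c p)\<^sup>2 * ?B j (snd p) \<partial>?S) \<le> (\<integral>p. (?c p)\<^sup>2 \<partial>?S)" .
  qed (use \<epsilon> in auto)
  also have "\<dots> = \<epsilon> / 2 * (1 + (L2_norm ?S (\<lambda>(u, v). c u v))\<^sup>2)"
    using \<epsilon> by (simp add: L2_norm_def case_prod_beta' integral_nonneg_AE algebra_simps power2_eq_square)
  finally show ?thesis .
qed

end

section \<open>Decay of conditional expectations along the chain\<close>

context real_markov_process
begin

lemma factor_through_present:
  fixes h :: "'a \<Rightarrow> real"
  assumes "h \<in> borel_measurable (present s)"
  obtains \<rho> where "\<rho> \<in> borel_measurable borel" "\<And>\<omega>. \<omega> \<in> space M \<Longrightarrow> h \<omega> = \<rho> (Y s \<omega>)"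
  by (rule doob_dynkin_real[OF assms, of "Y s"]) (auto simp: sets_generated_algebra_singleton)

lemma measurable_generated_mono:
  "f \<in> borel_measurable (generated_algebra M Y I) \<Longrightarrow> I \<subseteq> J
    \<Longrightarrow> f \<in> borel_measurable (generated_algebra M Y J)"
  using generated_algebra_mono[of I J M Y] by (auto simp: measurable_def)

abbreviation proj :: "int \<Rightarrow> ('a \<Rightarrow> real) \<Rightarrow> 'a \<Rightarrow> real" where
  "proj s f \<equiv> real_cond_exp M (present s) f"

lemma diff_proj_cond_centred_future:
  assumes "integrable M V" "V \<in> borel_measurable (past M Y s)"
  shows "cond_centred M (future M Y s) (\<lambda>\<omega>. V \<omega> - proj s V \<omega>)"
proof (rule cond_centred_future)
  have "proj s V \<in> borel_measurable (past M Y s)"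
    by (rule measurable_generated_mono[OF borel_measurable_cond_exp]) simp
  then show "(\<lambda>\<omega>. V \<omega> - proj s V \<omega>) \<in> borel_measurable (past M Y s)"
    using assms(2) by simp
qed (rule generated.cond_centred_diff_cond_exp[OF assms(1)])

text \<open>
  Against functions of the future, a function of the past may be replaced by its conditional
  expectation given the present, because the difference is centred given the future.
\<close>
lemma integral_bounded_past_future:
  assumes V: "integrable M V" "V \<in> borel_measurable (past M Y s)"
    and g: "g \<in> borel_measurable (future M Y s)" "AE \<omega> in M. \<bar>g \<omega>\<bar> \<le> K"
  shows "(\<integral>\<omega>. g \<omega> * V \<omega> \<partial>M) = (\<integral>\<omega>. g \<omega> * proj s V \<omega> \<partial>M)"
proof -
  have gM [measurable]: "g \<in> borel_measurable M"
    by (rule measurable_from_subalg[OF subalgebra_generated g(1)])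
  have int: "integrable M (\<lambda>\<omega>. g \<omega> * h \<omega>)" if h: "integrable M h" for h
  proof (rule Bochner_Integration.integrable_bound)
    show "integrable M (\<lambda>\<omega>. K * h \<omega>)" using h by simp
    show "AE \<omega> in M. norm (g \<omega> * h \<omega>) \<le> norm (K * h \<omega>)"
      using g(2) by eventually_elim (auto simp: abs_mult intro!: mult_right_mono)
  qed (use h in measurable)
  have P: "integrable M (proj s V)" by (rule generated.real_cond_exp_int(1)[OF V(1)])
  have "(\<integral>\<omega>. g \<omega> * (V \<omega> - proj s V \<omega>) \<partial>M) = 0"
    using int[of "\<lambda>\<omega>. V \<omega> - proj s V \<omega>"] V(1) P
    by (intro generated.cond_centred_integral_eq_0[OF diff_proj_cond_centred_future[OF V] g(1)]) auto
  then show ?thesis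
    using int[OF V(1)] int[OF P] by (simp add: right_diff_distrib)
qed

lemma proj_bounded:
  assumes "S \<in> borel_measurable M" "\<And>\<omega>. \<omega> \<in> space M \<Longrightarrow> \<bar>S \<omega>\<bar> \<le> K"
  shows "AE \<omega> in M. \<bar>proj s S \<omega>\<bar> \<le> K"
  using assms
  by (intro generated.real_cond_exp_bounded) (auto intro!: integrable_const_bound[of _ K])

text \<open>
  The mirror image for events: the replacement is made on the side of the past, moved across by the
  self-adjointness of conditional expectation, and undone.
\<close>
lemma integral_past_future_event:
  assumes V: "integrable M V" "V \<in> borel_measurable (past M Y s)" and B: "B \<in> sets (future M Y s)"
  shows "(\<integral>\<omega>. V \<omega> * indicator B \<omega> \<partial>M) = (\<integral>\<omega>. V \<omega> * proj s (indicator B) \<omega> \<partial>M)"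
proof -
  have BM [measurable]: "B \<in> sets M"
    using B subalgebra_generated by (auto simp: subalgebra_def)
  have b: "proj s (indicator B) \<in> borel_measurable (future M Y s)"
    by (rule measurable_generated_mono[OF borel_measurable_cond_exp]) simp
  have b1: "AE \<omega> in M. \<bar>proj s (indicator B) \<omega>\<bar> \<le> 1"
    by (rule proj_bounded) (auto split: split_indicator)
  have P: "integrable M (proj s V)" by (rule generated.real_cond_exp_int(1)[OF V(1)])
  have "(\<integral>\<omega>. indicator B \<omega> * V \<omega> \<partial>M) = (\<integral>\<omega>. proj s V \<omega> * indicator B \<omega> \<partial>M)"
    using integral_bounded_past_future[OF V, of "indicator B" 1] B
    by (simp add: mult.commute split: split_indicator)
  also have "\<dots> = (\<integral>\<omega>. proj s V \<omega> * proj s (indicator B) \<omega> \<partial>M)"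
    using integrable_mult_indicator[OF BM P]
    by (intro generated.real_cond_exp_intg(2)[symmetric]) (auto simp: mult.commute)
  also have "\<dots> = (\<integral>\<omega>. proj s (indicator B) \<omega> * V \<omega> \<partial>M)"
    using integral_bounded_past_future[OF V b b1] by (simp add: mult.commute)
  finally show ?thesis by (simp add: mult.commute)
qed

end

locale copula_markov_process = real_markov_process +
  fixes C :: "int \<Rightarrow> real \<Rightarrow> real \<Rightarrow> real" and \<eta> :: real
  assumes copula_of: "copula_of M (Y t) (Y (t + 1)) (C t)"
    and maximal_correlation_le: "maximal_correlation (C t) \<le> ennreal \<eta>"
    and \<eta>_pos: "0 < \<eta>"

sublocale copula_markov_process \<subseteq> coupling: copula_coupling M "Y t" "Y (t + 1)" "C t" for t
  by unfold_locales (auto simp: copula_of)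

context copula_markov_process
begin

text \<open>
  Let \<open>P\<close> and \<open>Q\<close> be the conditional expectations of \<open>S\<close> given \<open>Y s\<close> and given \<open>Y (s + 1)\<close>.
  Then \<open>E[Q\<^sup>2] = E[Q S]\<close> as \<open>Q\<close> is a projection of \<open>S\<close>, and \<open>E[Q S] = E[P Q]\<close> by the Markov
  property. The last integrand is a product of centred functions of \<open>Y s\<close> and \<open>Y (s + 1)\<close>, whence
  \<open>\<parallel>Q\<parallel>\<^sup>2 \<le> \<eta> \<parallel>P\<parallel> \<parallel>Q\<parallel>\<close>.
\<close>
lemma proj_contraction:
  assumes S: "S \<in> borel_measurable (past M Y s)" and bd: "\<And>\<omega>. \<omega> \<in> space M \<Longrightarrow> \<bar>S \<omega>\<bar> \<le> K"
    and S0: "(\<integral>\<omega>. S \<omega> \<partial>M) = 0"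
  shows "(\<integral>\<omega>. (proj (s + 1) S \<omega>)\<^sup>2 \<partial>M) \<le> \<eta>\<^sup>2 * (\<integral>\<omega>. (proj s S \<omega>)\<^sup>2 \<partial>M)"
proof -
  let ?P = "proj s S" and ?Q = "proj (s + 1) S"
  have SM [measurable]: "S \<in> borel_measurable M"
    by (rule measurable_from_subalg[OF subalgebra_generated S])
  have Sint: "integrable M S"
    using bd by (intro integrable_const_bound[of _ K]) auto
  have Qbd: "AE \<omega> in M. \<bar>?Q \<omega>\<bar> \<le> K" and Pbd: "AE \<omega> in M. \<bar>?P \<omega>\<bar> \<le> K"
    by (rule proj_bounded[OF SM bd]; simp)+
  have sq: "integrable M (\<lambda>\<omega>. (proj r S \<omega>)\<^sup>2)" for r
  proof -
    have "AE \<omega> in M. \<bar>proj r S \<omega>\<bar> \<le> K" by (rule proj_bounded[OF SM bd])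
    then have "AE \<omega> in M. norm ((proj r S \<omega>)\<^sup>2) \<le> K\<^sup>2"
      by eventually_elim (simp add: power2_le_iff_abs_le abs_le_square_iff[symmetric])
    then show ?thesis by (rule integrable_const_bound) simp
  qed
  have Q: "?Q \<in> borel_measurable (future M Y s)"
    by (rule measurable_generated_mono[OF borel_measurable_cond_exp]) simp
  have "integrable M (\<lambda>\<omega>. ?Q \<omega> * S \<omega>)"
  proof (rule Bochner_Integration.integrable_bound)
    show "integrable M (\<lambda>\<omega>. K * ?Q \<omega>)" using generated.real_cond_exp_int(1)[OF Sint] by simp
    show "AE \<omega> in M. norm (?Q \<omega> * S \<omega>) \<le> norm (K * ?Q \<omega>)"
    proof (rule AE_I2)
      fix \<omega> assume "\<omega> \<in> space M"
      then have "\<bar>S \<omega>\<bar> \<le> \<bar>K\<bar>" using bd[of \<omega>] by linarith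
      then show "norm (?Q \<omega> * S \<omega>) \<le> norm (K * ?Q \<omega>)"
        using mult_right_mono[of "\<bar>S \<omega>\<bar>" "\<bar>K\<bar>" "\<bar>?Q \<omega>\<bar>"] by (simp add: abs_mult mult.commute)
    qed
  qed simp
  then have "(\<integral>\<omega>. (?Q \<omega>)\<^sup>2 \<partial>M) = (\<integral>\<omega>. ?Q \<omega> * S \<omega> \<partial>M)"
    using generated.real_cond_exp_intg(2)[of ?Q S "{s + 1}"] by (simp add: power2_eq_square)
  also have "\<dots> = (\<integral>\<omega>. ?P \<omega> * ?Q \<omega> \<partial>M)"
    using integral_bounded_past_future[OF Sint S Q Qbd] by (simp add: mult.commute)
  also have "\<dots> \<le> \<eta> * sqrt (\<integral>\<omega>. (?P \<omega>)\<^sup>2 \<partial>M) * sqrt (\<integral>\<omega>. (?Q \<omega>)\<^sup>2 \<partial>M)"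
  proof -
    obtain p where p: "p \<in> borel_measurable borel" "\<And>\<omega>. \<omega> \<in> space M \<Longrightarrow> ?P \<omega> = p (Y s \<omega>)"
      by (rule factor_through_present[of ?P s]) auto
    obtain q where q: "q \<in> borel_measurable borel" "\<And>\<omega>. \<omega> \<in> space M \<Longrightarrow> ?Q \<omega> = q (Y (s + 1) \<omega>)"
      by (rule factor_through_present[of ?Q "s + 1"]) auto
    have "(\<integral>\<omega>. ?P \<omega> \<partial>M) = 0" "(\<integral>\<omega>. ?Q \<omega> \<partial>M) = 0"
      using generated.real_cond_exp_int(2)[OF Sint] S0 by simp_all
    then have "\<bar>\<integral>\<omega>. p (Y s \<omega>) * q (Y (s + 1) \<omega>) \<partial>M\<bar>
      \<le> \<eta> * sqrt (\<integral>\<omega>. (p (Y s \<omega>))\<^sup>2 \<partial>M) * sqrt (\<integral>\<omega>. (q (Y (s + 1) \<omega>))\<^sup>2 \<partial>M)"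
      using sq[of s] sq[of "s + 1"] \<eta>_pos maximal_correlation_le[of s]
      by (intro coupling.correlation_le p q)
        (simp_all add: p(2) q(2) cong: Bochner_Integration.integral_cong Bochner_Integration.integrable_cong)
    then show ?thesis
      by (simp add: p(2) q(2) cong: Bochner_Integration.integral_cong)
  qed
  finally have le: "(\<integral>\<omega>. (?Q \<omega>)\<^sup>2 \<partial>M) \<le> \<eta> * sqrt (\<integral>\<omega>. (?P \<omega>)\<^sup>2 \<partial>M) * sqrt (\<integral>\<omega>. (?Q \<omega>)\<^sup>2 \<partial>M)" .
  have nn: "0 \<le> (\<integral>\<omega>. (?Q \<omega>)\<^sup>2 \<partial>M)" "0 \<le> (\<integral>\<omega>. (?P \<omega>)\<^sup>2 \<partial>M)" by simp_all
  define x where "x = sqrt (\<integral>\<omega>. (?Q \<omega>)\<^sup>2 \<partial>M)"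
  define y where "y = sqrt (\<integral>\<omega>. (?P \<omega>)\<^sup>2 \<partial>M)"
  have xy: "0 \<le> x" "0 \<le> y" "(\<integral>\<omega>. (?Q \<omega>)\<^sup>2 \<partial>M) = x\<^sup>2" "(\<integral>\<omega>. (?P \<omega>)\<^sup>2 \<partial>M) = y\<^sup>2"
    using nn by (simp_all add: x_def y_def)
  have "x * x \<le> (\<eta> * y) * x"
    using le xy by (simp add: power2_eq_square)
  then have "x \<le> \<eta> * y"
    using xy \<eta>_pos by (cases "x = 0") (auto simp: mult_le_cancel_right)
  then have "x\<^sup>2 \<le> (\<eta> * y)\<^sup>2"
    using xy by (intro power_mono) auto
  then show ?thesis by (simp add: xy power_mult_distrib)
qed

lemma proj_decay:
  assumes S: "S \<in> borel_measurable (past M Y t)" and bd: "\<And>\<omega>. \<omega> \<in> space M \<Longrightarrow> \<bar>S \<omega>\<bar> \<le> K"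
    and S0: "(\<integral>\<omega>. S \<omega> \<partial>M) = 0"
  shows "(\<integral>\<omega>. (proj (t + int n) S \<omega>)\<^sup>2 \<partial>M) \<le> (K * \<eta> ^ n)\<^sup>2"
proof (induction n)
  case 0
  have SM: "S \<in> borel_measurable M"
    by (rule measurable_from_subalg[OF subalgebra_generated S])
  have "AE \<omega> in M. \<bar>proj t S \<omega>\<bar> \<le> K" by (rule proj_bounded[OF SM bd])
  then have le: "AE \<omega> in M. (proj t S \<omega>)\<^sup>2 \<le> K\<^sup>2"
    by eventually_elim (simp add: abs_le_square_iff[symmetric])
  then have "integrable M (\<lambda>\<omega>. (proj t S \<omega>)\<^sup>2)"
    by (intro integrable_const_bound[of _ "K\<^sup>2"]) auto
  then have "(\<integral>\<omega>. (proj t S \<omega>)\<^sup>2 \<partial>M) \<le> (\<integral>\<omega>. K\<^sup>2 \<partial>M)"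
    using le by (intro integral_mono_AE) auto
  then show ?case by (simp add: prob_space)
next
  case (Suc n)
  have "S \<in> borel_measurable (past M Y (t + int n))"
    by (rule measurable_generated_mono[OF S]) auto
  from proj_contraction[OF this bd S0]
  have "(\<integral>\<omega>. (proj (t + int n + 1) S \<omega>)\<^sup>2 \<partial>M) \<le> \<eta>\<^sup>2 * (K * \<eta> ^ n)\<^sup>2"
    using Suc mult_left_mono[OF Suc, of "\<eta>\<^sup>2"] by simp
  then show ?case by (simp add: power_mult_distrib ac_simps)
qed

end

section \<open>The mixing rate\<close>

lemma sum_indicator_partition:
  assumes "partition_on \<Omega> \<A>" "finite \<A>" "\<omega> \<in> \<Omega>"
  shows "(\<Sum>A\<in>\<A>. indicator A \<omega>) = (1::real)"
proof -
  have "disjoint_family_on (\<lambda>A. A) \<A>"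
    using partition_onD2[OF assms(1)] by (auto simp: disjoint_family_on_def disjoint_def)
  then have "(\<Sum>A\<in>\<A>. indicator A \<omega>) = (indicator (\<Union>A\<in>\<A>. A) \<omega> :: real)"
    using assms(2) by (subst indicator_UN_disjoint) auto
  then show ?thesis
    using partition_onD1[OF assms(1)] assms(3) by simp
qed

context copula_markov_process
begin

text \<open>
  The geometric factor comes from the \<open>n\<close> steps between \<open>t\<close> and \<open>m = t + n\<close>, where only correlations
  count; the density is used for the single step from \<open>m\<close> to \<open>m + 1\<close>, which makes the bound
  independent of the partitions.
\<close>
lemma partition_sum_le:
  assumes \<A>: "\<A> \<in> finite_partitions (past M Y t)" and \<B>: "\<B> \<in> finite_partitions (future M Y (t + int n + 1))"
    and c: "copula_density (C (t + int n)) c"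
    and c2: "square_integrable unit_square_lebesgue (\<lambda>(u, v). c u v)"
  shows "(\<Sum>A\<in>\<A>. \<Sum>B\<in>\<B>. \<bar>prob (A \<inter> B) - prob A * prob B\<bar>)
    \<le> \<eta> ^ n * (1 + (L2_norm unit_square_lebesgue (\<lambda>(u, v). c u v))\<^sup>2)"
proof -
  define m where "m = t + int n"
  let ?s = "\<lambda>A B. sgn (prob (A \<inter> B) - prob A * prob B)"
  have fin: "finite \<A>" "finite \<B>" and part: "partition_on (space M) \<A>" "partition_on (space M) \<B>"
    and sub: "\<A> \<subseteq> sets (past M Y t)" "\<B> \<subseteq> sets (future M Y (m + 1))"
    using \<A> \<B> by (auto simp: finite_partitions_def m_def)
  have AM [measurable]: "A \<in> sets M" if "A \<in> \<A>" for A
    using that sub subalgebra_generated unfolding subalgebra_def by blast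
  have BM [measurable]: "B \<in> sets M" if "B \<in> \<B>" for B
    using that sub subalgebra_generated unfolding subalgebra_def by blast

  \<comment> \<open>The signs turn the inner sum of absolute values into one integral of a function of the past. Its
    centred version \<open>S B\<close> also produces the products \<open>prob A * prob B\<close>.\<close>
  define T where "T B \<omega> = (\<Sum>A\<in>\<A>. ?s A B * indicator A \<omega>)" for B \<omega>
  define S where "S B \<omega> = T B \<omega> - expectation (T B)" for B \<omega>
  have T_meas [measurable]: "T B \<in> borel_measurable (past M Y t)" for B
    unfolding T_def using sub by (intro borel_measurable_sum) auto
  have TM [measurable]: "T B \<in> borel_measurable M" for B
    by (rule measurable_from_subalg[OF subalgebra_generated T_meas])
  have T_bd: "\<bar>T B \<omega>\<bar> \<le> 1" if "\<omega> \<in> space M" for B \<omega>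
  proof -
    have "\<bar>T B \<omega>\<bar> \<le> (\<Sum>A\<in>\<A>. \<bar>?s A B * indicator A \<omega>\<bar>)"
      unfolding T_def by (rule sum_abs)
    also have "\<dots> \<le> (\<Sum>A\<in>\<A>. indicator A \<omega>)"
      by (intro sum_mono) (auto simp: abs_mult abs_sgn_eq split: split_indicator)
    finally show ?thesis using sum_indicator_partition[OF part(1) fin(1) that] by simp
  qed
  have T_int: "integrable M (T B)" for B
    using T_bd by (intro integrable_const_bound[of _ 1]) auto
  have ET: "\<bar>expectation (T B)\<bar> \<le> 1" for B
  proof -
    have "\<bar>expectation (T B)\<bar> \<le> expectation (\<lambda>\<omega>. \<bar>T B \<omega>\<bar>)" by (rule integral_abs_bound)
    also have "\<dots> \<le> expectation (\<lambda>\<omega>. 1)"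
      using T_int T_bd by (intro integral_mono) auto
    finally show ?thesis by (simp add: prob_space)
  qed
  have S_meas: "S B \<in> borel_measurable (past M Y t)" for B
    unfolding S_def by simp
  have SM: "S B \<in> borel_measurable M" for B
    by (rule measurable_from_subalg[OF subalgebra_generated S_meas])
  have S_bd: "\<bar>S B \<omega>\<bar> \<le> 2" if "\<omega> \<in> space M" for B \<omega>
    using T_bd[OF that, of B] ET[of B] unfolding S_def by linarith
  have S_int: "integrable M (S B)" for B
    unfolding S_def using T_int by simp
  have S0: "expectation (S B) = 0" for B
    unfolding S_def using T_int by (simp add: prob_space)
  have S_indicator: "(\<Sum>A\<in>\<A>. \<bar>prob (A \<inter> B) - prob A * prob B\<bar>) = (\<integral>\<omega>. S B \<omega> * indicator B \<omega> \<partial>M)"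
    if B: "B \<in> \<B>" for B
  proof -
    have [measurable]: "B \<in> sets M" by (rule BM[OF B])
    have "(\<integral>\<omega>. S B \<omega> * indicator B \<omega> \<partial>M)
        = (\<integral>\<omega>. (\<Sum>A\<in>\<A>. ?s A B * indicator (A \<inter> B) \<omega>) - expectation (T B) * indicator B \<omega> \<partial>M)"
      by (simp add: S_def T_def left_diff_distrib sum_distrib_right indicator_inter_arith mult.assoc)
    also have "\<dots> = (\<integral>\<omega>. (\<Sum>A\<in>\<A>. ?s A B * indicator (A \<inter> B) \<omega>) \<partial>M) - (\<integral>\<omega>. expectation (T B) * indicator B \<omega> \<partial>M)"
      using AM by (intro Bochner_Integration.integral_diff Bochner_Integration.integrable_sum integrable_mult_right integrable_real_indicator) (auto simp: emeasure_eq_measure)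
    also have "(\<integral>\<omega>. (\<Sum>A\<in>\<A>. ?s A B * indicator (A \<inter> B) \<omega>) \<partial>M) = (\<Sum>A\<in>\<A>. ?s A B * prob (A \<inter> B))"
      using AM by (subst Bochner_Integration.integral_sum) (auto intro!: sum.cong simp: emeasure_eq_measure)
    also have "expectation (T B) = (\<Sum>A\<in>\<A>. ?s A B * prob A)"
      unfolding T_def using AM by (subst Bochner_Integration.integral_sum) (auto intro!: sum.cong simp: emeasure_eq_measure)
    also have "(\<integral>\<omega>. (\<Sum>A\<in>\<A>. ?s A B * prob A) * indicator B \<omega> \<partial>M) = (\<Sum>A\<in>\<A>. ?s A B * prob A) * prob B"
      by simp
    also have "(\<Sum>A\<in>\<A>. ?s A B * prob (A \<inter> B)) - (\<Sum>A\<in>\<A>. ?s A B * prob A) * prob B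
        = (\<Sum>A\<in>\<A>. ?s A B * (prob (A \<inter> B) - prob A * prob B))"
      by (simp add: sum_distrib_right right_diff_distrib sum_subtractf mult.assoc)
    also have "\<dots> = (\<Sum>A\<in>\<A>. \<bar>prob (A \<inter> B) - prob A * prob B\<bar>)"
      by (intro sum.cong refl) (simp add: abs_sgn mult.commute)
    finally show ?thesis by simp
  qed

  let ?R = "\<lambda>B. proj m (S B)" and ?b = "\<lambda>B. proj (m + 1) (indicator B)"
  have R_int: "integrable M (?R B)" for B
    by (rule generated.real_cond_exp_int(1)[OF S_int])
  have R_ind: "(\<integral>\<omega>. S B \<omega> * indicator B \<omega> \<partial>M) = (\<integral>\<omega>. ?R B \<omega> * ?b B \<omega> \<partial>M)" if B: "B \<in> \<B>" for B
  proof -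
    have Bf: "B \<in> sets (future M Y (m + 1))" using sub B by auto
    then have "B \<in> sets (future M Y m)"
      using generated_algebra_mono[of "{m + 1..}" "{m..}" M Y] by auto
    then have "(\<integral>\<omega>. indicator B \<omega> * S B \<omega> \<partial>M) = (\<integral>\<omega>. indicator B \<omega> * ?R B \<omega> \<partial>M)"
      by (intro integral_bounded_past_future[of _ _ _ 1] S_int measurable_generated_mono[OF S_meas])
        (auto simp: m_def split: split_indicator)
    also have "\<dots> = (\<integral>\<omega>. ?R B \<omega> * ?b B \<omega> \<partial>M)"
      using integral_past_future_event[OF R_int[of B] _ Bf]
        measurable_generated_mono[OF borel_measurable_cond_exp, of "{m}" "{..m + 1}" M "S B"]
      by (simp add: mult.commute)
    finally show ?thesis by (simp add: mult.commute)
  qed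

  have "\<exists>r. r \<in> borel_measurable borel \<and> (\<forall>\<omega>\<in>space M. ?R B \<omega> = r (Y m \<omega>))" for B
    by (rule factor_through_present[OF borel_measurable_cond_exp, of M m "S B"]) blast
  then obtain r where r: "\<And>B. r B \<in> borel_measurable borel"
      "\<And>B \<omega>. \<omega> \<in> space M \<Longrightarrow> ?R B \<omega> = r B (Y m \<omega>)"
    by metis
  have "\<exists>b. b \<in> borel_measurable borel \<and> (\<forall>\<omega>\<in>space M. ?b B \<omega> = b (Y (m + 1) \<omega>))" for B
    by (rule factor_through_present[OF borel_measurable_cond_exp, of M "m + 1" "indicator B"]) blast
  then obtain b where b [measurable]: "\<And>B. b B \<in> borel_measurable borel"
    and b_eq: "\<And>B \<omega>. \<omega> \<in> space M \<Longrightarrow> ?b B \<omega> = b B (Y (m + 1) \<omega>)"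
    by metis
  \<comment> \<open>The conditional probabilities form a partition of unity only almost surely. They are set to 0
    at the exceptional points, so that the bounds hold everywhere.\<close>
  define valid where "valid z \<longleftrightarrow> (\<forall>B\<in>\<B>. 0 \<le> b B z) \<and> (\<Sum>B\<in>\<B>. b B z) \<le> 1" for z
  define b' where "b' B z = (if valid z then b B z else 0)" for B z
  have b'_meas: "b' B \<in> borel_measurable borel" for B
    unfolding b'_def valid_def using fin by measurable
  have valid: "AE \<omega> in M. valid (Y (m + 1) \<omega>)"
  proof -
    have "AE \<omega> in M. 0 \<le> ?b B \<omega>" if "B \<in> \<B>" for B
      using BM[OF that] by (intro generated.real_cond_exp_pos) auto
    then have nn: "AE \<omega> in M. \<forall>B\<in>\<B>. 0 \<le> ?b B \<omega>"
      using fin by (subst AE_finite_all) auto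
    have "AE \<omega> in M. proj (m + 1) (\<lambda>\<omega>. \<Sum>B\<in>\<B>. indicator B \<omega>) \<omega> = (\<Sum>B\<in>\<B>. ?b B \<omega>)"
    proof -
      \<comment> \<open>Additivity asks for integrability at every index, also outside \<open>\<B>\<close>.\<close>
      let ?f = "\<lambda>B. indicat_real (if B \<in> \<B> then B else {})"
      have "AE \<omega> in M. proj (m + 1) (\<lambda>\<omega>. \<Sum>B\<in>\<B>. ?f B \<omega>) \<omega> = (\<Sum>B\<in>\<B>. proj (m + 1) (?f B) \<omega>)"
        by (rule generated.real_cond_exp_sum) (auto simp: BM emeasure_eq_measure)
      then show ?thesis by (simp cong: sum.cong)
    qed
    moreover have "AE \<omega> in M. proj (m + 1) (\<lambda>\<omega>. \<Sum>B\<in>\<B>. indicator B \<omega>) \<omega> = proj (m + 1) (\<lambda>\<omega>. 1) \<omega>"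
      using sum_indicator_partition[OF part(2) fin(2)] BM
      by (intro generated.real_cond_exp_cong AE_I2 borel_measurable_sum) auto
    moreover have "AE \<omega> in M. proj (m + 1) (\<lambda>\<omega>. 1) \<omega> = 1"
      by (rule generated.real_cond_exp_F_meas) auto
    ultimately show ?thesis
      using nn AE_space by eventually_elim (simp add: valid_def b_eq)
  qed
  have "(\<Sum>A\<in>\<A>. \<Sum>B\<in>\<B>. \<bar>prob (A \<inter> B) - prob A * prob B\<bar>)
      = (\<Sum>B\<in>\<B>. \<Sum>A\<in>\<A>. \<bar>prob (A \<inter> B) - prob A * prob B\<bar>)"
    by (rule sum.swap)
  also have "\<dots> = (\<Sum>B\<in>\<B>. \<integral>\<omega>. ?R B \<omega> * ?b B \<omega> \<partial>M)"
    using S_indicator R_ind by simp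
  also have "\<dots> = (\<Sum>B\<in>\<B>. \<integral>\<omega>. r B (Y m \<omega>) * b' B (Y (m + 1) \<omega>) \<partial>M)"
  proof (intro sum.cong refl integral_cong_AE)
    fix B
    show "AE \<omega> in M. ?R B \<omega> * ?b B \<omega> = r B (Y m \<omega>) * b' B (Y (m + 1) \<omega>)"
      using valid AE_space by eventually_elim (simp add: r(2) b_eq b'_def)
    show "(\<lambda>\<omega>. r B (Y m \<omega>) * b' B (Y (m + 1) \<omega>)) \<in> borel_measurable M"
      using r(1)[of B] b'_meas[of B] by measurable
  qed simp
  also have "\<dots> \<le> (2 * \<eta> ^ n) / 2 * (1 + (L2_norm unit_square_lebesgue (\<lambda>(u, v). c u v))\<^sup>2)"
  proof (rule coupling.sum_integral_density_le)
    show "copula_density (C m) c" using c by (simp add: m_def)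
    fix B z
    have "(\<integral>\<omega>. (?R B \<omega>)\<^sup>2 \<partial>M) \<le> (2 * \<eta> ^ n)\<^sup>2"
      unfolding m_def by (rule proj_decay[OF S_meas S_bd S0])
    then show "(\<integral>\<omega>. (r B (Y m \<omega>))\<^sup>2 \<partial>M) \<le> (2 * \<eta> ^ n)\<^sup>2"
      by (simp add: r(2) cong: Bochner_Integration.integral_cong)
    have "AE \<omega> in M. \<bar>?R B \<omega>\<bar> \<le> 2" by (rule proj_bounded[OF SM S_bd])
    then have "AE \<omega> in M. norm ((?R B \<omega>)\<^sup>2) \<le> 2\<^sup>2"
      by eventually_elim (use abs_le_square_iff[of _ 2] in fastforce)
    then have "integrable M (\<lambda>\<omega>. (?R B \<omega>)\<^sup>2)"
      by (rule integrable_const_bound) simp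
    then show "integrable M (\<lambda>\<omega>. (r B (Y m \<omega>))\<^sup>2)"
      by (simp add: r(2) cong: Bochner_Integration.integrable_cong)
    show "B \<in> \<B> \<Longrightarrow> 0 \<le> b' B z" by (simp add: b'_def valid_def)
    show "(\<Sum>B\<in>\<B>. b' B z) \<le> 1"
      by (cases "valid z") (simp_all add: b'_def, simp add: valid_def)
  qed (use fin c2 r b'_meas \<eta>_pos in auto)
  finally show ?thesis by simp
qed

end

theorem theorem2p1:
  fixes M :: "'a measure"
    and Y :: "int \<Rightarrow> 'a \<Rightarrow> real"
    and C c :: "int \<Rightarrow> real \<Rightarrow> real \<Rightarrow> real"
  assumes "markov_process M Y"
    and "\<And>t. copula_of M (Y t) (Y (t + 1)) (C t)"
    and "\<And>t. copula_density (C t) (c t)"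
    and "\<And>t. symmetric_on_unit_square (c t)"
    and "\<And>t. square_integrable unit_square_lebesgue (\<lambda>(u, v). c t u v)"
    and "(SUP t. ennreal (L2_norm unit_square_lebesgue (\<lambda>(u, v). c t u v))) < \<infinity>"
    and "(SUP t. maximal_correlation (C t)) < 1"
  shows "beta_mixing M Y"
proof -
  let ?L = "\<lambda>t. L2_norm unit_square_lebesgue (\<lambda>(u, v). c t u v)"
  obtain K where K: "0 \<le> K" "(SUP t. ennreal (?L t)) = ennreal K"
    using assms(6) by (cases "SUP t. ennreal (?L t)") auto
  have L_le: "?L t \<le> K" for t
  proof -
    have "ennreal (?L t) \<le> ennreal K"
      unfolding K(2)[symmetric] by (rule SUP_upper) simp
    then show ?thesis using K(1) by (simp add: ennreal_le_iff)
  qed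
  obtain e where e: "0 \<le> e" "(SUP t. maximal_correlation (C t)) = ennreal e"
    using assms(7) by (cases "SUP t. maximal_correlation (C t)") auto
  \<comment> \<open>The maximum keeps \<open>\<eta>\<close> positive: a multiple of \<open>\<eta> ^ n\<close> becomes the weight \<open>\<epsilon>\<close> of
    \<open>sum_integral_density_le\<close>, which occurs as a divisor.\<close>
  define \<eta> where "\<eta> = max e (1 / 2)"
  have \<eta>: "0 < \<eta>" "\<eta> < 1"
    using assms(7) e by (auto simp: \<eta>_def ennreal_less_one_iff)
  have mc: "maximal_correlation (C t) \<le> ennreal \<eta>" for t
  proof -
    have "maximal_correlation (C t) \<le> ennreal e"
      unfolding e(2)[symmetric] by (rule SUP_upper) simp
    also have "\<dots> \<le> ennreal \<eta>" by (simp add: \<eta>_def ennreal_leI)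
    finally show ?thesis .
  qed
  interpret copula_markov_process M Y C \<eta>
    by unfold_locales (use assms mc \<eta> in auto)
  have beta_le: "beta_coefficient M Y (Suc n) \<le> ennreal (1 / 2 * (\<eta> ^ n * (1 + K\<^sup>2)))" for n
    unfolding beta_coefficient_def beta_dependence_def
  proof (intro SUP_least, clarify, intro ennreal_leI mult_left_mono)
    fix t \<A> \<B>
    assume \<A>: "\<A> \<in> finite_partitions (past M Y t)"
      and \<B>: "\<B> \<in> finite_partitions (future M Y (t + int (Suc n)))"
    have "t + int (Suc n) = t + int n + 1" by simp
    with \<B> have "\<B> \<in> finite_partitions (future M Y (t + int n + 1))" by (simp only:)
    from partition_sum_le[OF \<A> this assms(3,5)]
    have "(\<Sum>A\<in>\<A>. \<Sum>B\<in>\<B>. \<bar>prob (A \<inter> B) - prob A * prob B\<bar>) \<le> \<eta> ^ n * (1 + (?L (t + int n))\<^sup>2)" .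
    also have "\<dots> \<le> \<eta> ^ n * (1 + K\<^sup>2)"
      using \<eta> L_le[of "t + int n"]
      by (intro mult_left_mono add_left_mono power_mono) (auto simp: L2_norm_def)
    finally show "(\<Sum>A\<in>\<A>. \<Sum>B\<in>\<B>. \<bar>prob (A \<inter> B) - prob A * prob B\<bar>) \<le> \<eta> ^ n * (1 + K\<^sup>2)" .
  qed simp
  have "(\<lambda>n. \<eta> ^ n) \<longlonglongrightarrow> 0"
    using \<eta> by (intro LIMSEQ_realpow_zero) auto
  then have "(\<lambda>n. ennreal (1 / 2 * (\<eta> ^ n * (1 + K\<^sup>2)))) \<longlonglongrightarrow> ennreal (1 / 2 * (0 * (1 + K\<^sup>2)))"
    by (intro tendsto_ennrealI tendsto_mult tendsto_const)
  then have lim: "(\<lambda>n. ennreal (1 / 2 * (\<eta> ^ n * (1 + K\<^sup>2)))) \<longlonglongrightarrow> 0"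
    by simp
  have "(\<lambda>n. beta_coefficient M Y (Suc n)) \<longlonglongrightarrow> 0"
    by (rule tendsto_sandwich[OF always_eventually always_eventually tendsto_const lim])
      (simp_all only: beta_le zero_le simp_thms)
  then show ?thesis
    unfolding beta_mixing_def by (rule LIMSEQ_imp_Suc)
qed

end
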